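(* Let $S\subset\mathbb{R}^3$ be a rational ruled surface properly parametrized by $\boldsymbol{x}(t,s)=\boldsymbol{p}(t)+s\cdot\boldsymbol{q}(t)$, where $\boldsymbol{q}(t)=(q_1(t),q_2(t),q_3(t))$ with $q_i(t)\in\mathbb{R}[t]$ and $\gcd(q_1,q_2,q_3)=1$, and assume that $S$ is not doubly ruled, not cylindrical, and not a surface of revolution. Let $n=\max\{\deg q_1,\deg q_2,\deg q_3\}$. Let $f(\mathbf{x})=\boldsymbol{Q}\mathbf{x}+\boldsymbol{b}$ be a symmetry of $S$, and let $\varphi:\mathbb{R}^2\dashrightarrow\mathbb{R}^2$ be the birational transformation such that $f\circ\boldsymbol{x}=\boldsymbol{x}\circ\varphi$. Then $$\varphi(t,s)=\bigl(\psi(t),\;k\cdot(\gamma t+\delta)^n\cdot s+c(t)\bigr),$$ where $\psi(t)=\dfrac{\alpha t+\beta}{\gamma t+\delta}$ is a Möbius transformation ($\alpha,\beta,\gamma,\delta\in\mathbb{R}$, $\alpha\delta-\beta\gamma\neq0$), $k$ is a real constant, and $c(t)$ is a rational function.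
   Context: $\boldsymbol{p}(t)$ is a triple of real rational functions of $t$. The surface $S\subset\mathbb{R}^3$ is the irreducible real algebraic surface (Zariski closure of the image) parametrized by $\boldsymbol{x}$. The parametrization is proper if $\boldsymbol{x}:\mathbb{R}^2\dashrightarrow S$ is birational, i.e. it has a rational inverse. The rulings of $S$ are the lines $s\mapsto\boldsymbol{x}(t_0,s)$. $S$ is doubly ruled if there are two different families of rulings contained in $S$ (the doubly ruled surfaces are the plane, the hyperbolic paraboloid and the single-sheeted hyperboloid). $S$ is cylindrical if $\boldsymbol{q}(t)$ is a multiple of a constant vector. An isometry of $\mathbb{R}^3$ is a map $f(\mathbf{x})=\boldsymbol{Q}\mathbf{x}+\boldsymbol{b}$ with $\boldsymbol{Q}$ a real orthogonal $3\times3$ matrix and $\boldsymbol{b}\in\mathbb{R}^3$; it is a symmetry of $S$ if $f(S)=S$. For each symmetry $f$ of $S$ there is a unique birational transformation $\varphi:\mathbb{R}^2\dashrightarrow\mathbb{R}^2$ (given by real rational functions) with $f(\boldsymbol{x}(t,s))=\boldsymbol{x}(\varphi(t,s))$ for generic $(t,s)$. *)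

theory Defs
  imports "HOL-Analysis.Analysis" "HOL-Computational_Algebra.Computational_Algebra"
    "HOL-Computational_Algebra.Field_as_Ring"
begin

section \<open>Real algebraic sets and rational maps\<close>

definition zariski_closure :: "'a::euclidean_space set \<Rightarrow> 'a set" where
  "zariski_closure A =
     {x. \<forall>P. real_polynomial_function P \<longrightarrow> (\<forall>a\<in>A. P a = 0) \<longrightarrow> P x = 0}"

text \<open>
  A property holds for generic points of \<open>V\<close> if it holds on a nonempty basic Zariski open subset
  of \<open>V\<close>. This is the usual notion when \<open>V\<close> is irreducible; all uses below are of this kind
  (the plane, and Zariski closures of images of the plane under rational maps).
\<close>

definition generic_on :: "'a::euclidean_space set \<Rightarrow> ('a \<Rightarrow> bool) \<Rightarrow> bool" where
  "generic_on V P \<longleftrightarrow>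
     (\<exists>D. real_polynomial_function D \<and> (\<exists>v\<in>V. D v \<noteq> 0) \<and> (\<forall>v\<in>V. D v \<noteq> 0 \<longrightarrow> P v))"

text \<open>
  A rational map is represented by a total HOL function that agrees with a quotient of polynomials
  on a nonempty Zariski open set. The values elsewhere are irrelevant, and two functions represent
  the same rational map iff they agree generically.
\<close>

definition rational_function_on :: "'a::euclidean_space set \<Rightarrow> ('a \<Rightarrow> real) \<Rightarrow> bool" where
  "rational_function_on V h \<longleftrightarrow>
     (\<exists>N D. real_polynomial_function N \<and> real_polynomial_function D \<and>
        (\<exists>v\<in>V. D v \<noteq> 0) \<and> (\<forall>v\<in>V. D v \<noteq> 0 \<longrightarrow> h v = N v / D v))"

text \<open>
  Dominance (the preimage of a nonempty Zariski open set is generic) makes composition of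
  rational maps well defined.
\<close>

definition dominant_rational_map ::
  "'a::euclidean_space set \<Rightarrow> 'b::euclidean_space set \<Rightarrow> ('a \<Rightarrow> 'b) \<Rightarrow> bool" where
  "dominant_rational_map V W h \<longleftrightarrow>
     (\<forall>b\<in>Basis. rational_function_on V (\<lambda>v. h v \<bullet> b)) \<and>
     generic_on V (\<lambda>v. h v \<in> W) \<and>
     (\<forall>D. real_polynomial_function D \<longrightarrow> (\<exists>w\<in>W. D w \<noteq> 0) \<longrightarrow> generic_on V (\<lambda>v. D (h v) \<noteq> 0))"

definition birational_map ::
  "'a::euclidean_space set \<Rightarrow> 'b::euclidean_space set \<Rightarrow> ('a \<Rightarrow> 'b) \<Rightarrow> bool" where
  "birational_map V W h \<longleftrightarrow>
     dominant_rational_map V W h \<and>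
     (\<exists>g. dominant_rational_map W V g \<and>
        generic_on V (\<lambda>v. g (h v) = v) \<and> generic_on W (\<lambda>w. h (g w) = w))"

section \<open>Evaluation of univariate rational functions\<close>

text \<open>
  \<^const>\<open>quot_of_fract\<close> yields the reduced numerator and denominator, so \<open>regular_at\<close> says
  that \<open>t\<close> is not a pole; at a pole \<open>rat_eval\<close> has the junk value 0.
\<close>

definition regular_at :: "real poly fract \<Rightarrow> real \<Rightarrow> bool" where
  "regular_at r t \<longleftrightarrow> poly (snd (quot_of_fract r)) t \<noteq> 0"

definition rat_eval :: "real poly fract \<Rightarrow> real \<Rightarrow> real" where
  "rat_eval r t = poly (fst (quot_of_fract r)) t / poly (snd (quot_of_fract r)) t"

section \<open>Rational ruled surfaces\<close>

definition ruled_map :: "real poly fract ^ 3 \<Rightarrow> real poly ^ 3 \<Rightarrow> real \<times> real \<Rightarrow> real ^ 3" where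
  "ruled_map p q = (\<lambda>(t, s). (\<chi> i. rat_eval (p $ i) t) + s *\<^sub>R (\<chi> i. poly (q $ i) t))"

definition ruled_dom :: "real poly fract ^ 3 \<Rightarrow> real set" where
  "ruled_dom p = {t. \<forall>i. regular_at (p $ i) t}"

definition ruled_surface :: "real poly fract ^ 3 \<Rightarrow> real poly ^ 3 \<Rightarrow> (real ^ 3) set" where
  "ruled_surface p q = zariski_closure (ruled_map p q ` (ruled_dom p \<times> UNIV))"

definition properly_parametrizes ::
  "real poly fract ^ 3 \<Rightarrow> real poly ^ 3 \<Rightarrow> (real ^ 3) set \<Rightarrow> bool" where
  "properly_parametrizes p q S \<longleftrightarrow>
     S = ruled_surface p q \<and> birational_map UNIV S (ruled_map p q)"

definition rulings :: "real poly fract ^ 3 \<Rightarrow> real poly ^ 3 \<Rightarrow> (real ^ 3) set set" where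
  "rulings p q = {range (\<lambda>s. ruled_map p q (t, s)) |t. t \<in> ruled_dom p}"

text \<open>
  Proper ruled parametrizations with the same family of rulings differ in the base parameter by a
  real Moebius transformation, so their sets of rulings agree up to finitely many lines (parameters
  at poles or at infinity are missing). Conversely, the lines of two different families have only
  finitely many members in common. Hence two families are different iff the symmetric difference
  of the sets of rulings is infinite.
\<close>

definition doubly_ruled :: "(real ^ 3) set \<Rightarrow> bool" where
  "doubly_ruled S \<longleftrightarrow>
     (\<exists>p q p' q'. properly_parametrizes p q S \<and> properly_parametrizes p' q' S \<and>
        infinite ((rulings p q - rulings p' q') \<union> (rulings p' q' - rulings p q)))"

definition cylindrical :: "real poly ^ 3 \<Rightarrow> bool" where
  "cylindrical q \<longleftrightarrow> (\<exists>(r :: real poly) (v :: real ^ 3). \<forall>i. q $ i = smult (v $ i) r)"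

text \<open>Invariance under all rotations about some axis \<open>{a + u *\<^sub>R d |u. True}\<close>.\<close>

definition surface_of_revolution :: "(real ^ 3) set \<Rightarrow> bool" where
  "surface_of_revolution S \<longleftrightarrow>
     (\<exists>a d. d \<noteq> 0 \<and>
        (\<forall>Q :: real ^ 3 ^ 3. rotation_matrix Q \<longrightarrow> Q *v d = d \<longrightarrow>
           (\<lambda>x. a + Q *v (x - a)) ` S = S))"

definition isometry_symmetry :: "(real ^ 3) set \<Rightarrow> real ^ 3 ^ 3 \<Rightarrow> real ^ 3 \<Rightarrow> bool" where
  "isometry_symmetry S Q b \<longleftrightarrow> orthogonal_matrix Q \<and> (\<lambda>x. Q *v x + b) ` S = S"

end

theory Submission
  imports Defs
begin

text \<open>
  The symmetry \<open>f\<close> carries the ruled parametrization to a second proper ruled parametrization of the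
  same surface. As \<open>S\<close> is not doubly ruled, \<open>f\<close> permutes the rulings up to finitely many, so
  \<open>\<phi> (t, s) = (\<psi> t, a t * s + c t)\<close>. The same holds for the inverse symmetry, hence \<open>\<psi>\<close> is a rational
  function with a rational left inverse, that is, a Moebius transformation. Comparing directions,
  \<open>(\<gamma> t + \<delta>)\<^sup>n Q q(t) = a(t) h(t)\<close> with \<open>h(t) = (\<gamma> t + \<delta>)\<^sup>n q(\<psi> t)\<close> polynomial of degree at most \<open>n\<close>.
  Since \<open>Q q\<close> is primitive of degree \<open>n\<close>, \<open>h\<close> is a constant multiple of it, which determines \<open>a\<close>.

  Almost all pairs \<open>(t, s)\<close> are expressed by nested cofinite filters, first in \<open>t\<close>, then in \<open>s\<close>; this is
  weaker than \<open>generic_on UNIV\<close>, but equivalent for equations between rational functions.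
\<close>

subsection \<open>Polynomial functions and cofinite sets\<close>

text \<open>Invariance of \<open>S\<close> under \<open>f\<close> does not by itself send rulings to
  rulings; it only yields two parametrizations of one surface. Negating \<open>doubly_ruled\<close>
  for these two leaves finitely many exceptional lines, and these come from finitely many
  parameters, because the rational inverse of \<open>ruled_map p q\<close> recovers the parameter
  from the line. The functions \<open>\<psi>\<close>, \<open>a\<close> and \<open>c\<close> so
  obtained are bare choices, made separately for each \<open>t\<close>. Rationality is regained in a
  forced order: \<open>\<psi>\<close> from the first component of \<open>\<phi>\<close>, then
  \<open>a\<close> from the directions, and \<open>c\<close> from the second component of
  \<open>\<phi>\<close> once the known \<open>a\<close> can be subtracted. Over the reals,
  injectivity would not make the rational function \<open>\<psi>\<close> a Moebius transformation,
  as \<open>t ^ 3\<close> shows. This is why the inverse of \<open>\<phi>\<close> is analysed as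
  well: degrees and coprimality then decide, without passing to the complex numbers. The exponent
  \<open>n\<close> arises from clearing the denominators of all three coordinates of
  \<open>q(\<psi> t)\<close> by one common power.\<close>

lemma real_polynomial_function_poly:
  "real_polynomial_function f \<Longrightarrow> real_polynomial_function (\<lambda>x. poly p (f x))"
  by (induction p) auto

lemma real_polynomial_function_imp_poly:
  fixes f :: "real \<Rightarrow> real"
  assumes "real_polynomial_function f"
  obtains p where "f = poly p"
proof -
  have "\<exists>p. f = poly p"
    using assms
  proof (induction f rule: real_polynomial_function.induct)
    case (linear f)
    then obtain c where "f = (\<lambda>x. x * c)" by (auto simp: real_bounded_linear)
    then have "f = poly [:0, c:]" by auto
    then show ?case ..
  next
    case (const c)
    have "(\<lambda>x. c) = poly [:c:]" by auto
    then show ?case ..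
  next
    case (add f g)
    then obtain p r where "f = poly p" "g = poly r" by auto
    then have "(\<lambda>x. f x + g x) = poly (p + r)" by auto
    then show ?case ..
  next
    case (mult f g)
    then obtain p r where "f = poly p" "g = poly r" by auto
    then have "(\<lambda>x. f x * g x) = poly (p * r)" by auto
    then show ?case ..
  qed
  then show ?thesis using that by blast
qed

lemma poly_eventually_nonzero:
  fixes p :: "real poly"
  assumes "p \<noteq> 0"
  shows "\<forall>\<^sub>F t in cofinite. poly p t \<noteq> 0"
  using poly_roots_finite[OF assms] by (simp add: eventually_cofinite)

lemma poly_eqI_cofinite:
  fixes p r :: "real poly"
  assumes "\<forall>\<^sub>F t in cofinite. poly p t = poly r t"
  shows "p = r"
proof (rule ccontr)
  assume "p \<noteq> r"
  then have "\<forall>\<^sub>F t in cofinite. poly (p - r) t \<noteq> 0" by (intro poly_eventually_nonzero) simp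
  with assms have "\<forall>\<^sub>F t::real in cofinite. False" by eventually_elim simp
  then show False by (simp add: infinite_UNIV_char_0)
qed

lemma real_polynomial_function_eventually_nonzero:
  fixes f :: "real \<Rightarrow> real"
  assumes "real_polynomial_function f" and "f x \<noteq> 0"
  shows "\<forall>\<^sub>F t in cofinite. f t \<noteq> 0"
proof -
  obtain p where p: "f = poly p" using real_polynomial_function_imp_poly assms(1) by blast
  with assms(2) have "p \<noteq> 0" by auto
  then show ?thesis using poly_eventually_nonzero p by simp
qed

lemma eventually_cofinite_neq: "\<forall>\<^sub>F x in cofinite. x \<noteq> a"
  by (simp add: eventually_cofinite)

lemma eventually_cofinite_realE:
  assumes "\<forall>\<^sub>F x::real in cofinite. P x"
  obtains x where "P x"
  using eventually_happens'[OF _ assms] by (auto simp: infinite_UNIV_char_0)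

text \<open>Injectivity pulls a finite exceptional set back to a finite one. The conclusion is the
  form in which a statement about almost all points is composed with \<open>f\<close>.\<close>

lemma filterlim_cofinite_inj_on:
  fixes f :: "'a \<Rightarrow> 'b"
  assumes inj: "inj_on f A" and ev: "\<forall>\<^sub>F x in cofinite. x \<in> A"
  shows "filterlim f cofinite cofinite"
  unfolding filterlim_iff
proof (intro allI impI)
  fix P :: "'b \<Rightarrow> bool" assume "\<forall>\<^sub>F y in cofinite. P y"
  then have "finite {y. \<not> P y}" by (simp add: eventually_cofinite)
  then have "finite (f -` {y. \<not> P y} \<inter> A)" using inj by (rule finite_vimage_IntI)
  moreover have "finite {x. x \<notin> A}" using ev by (simp add: eventually_cofinite)
  ultimately have "finite ((f -` {y. \<not> P y} \<inter> A) \<union> {x. x \<notin> A})" by blast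
  then show "\<forall>\<^sub>F x in cofinite. P (f x)"
    unfolding eventually_cofinite by (rule rev_finite_subset) auto
qed

lemma filterlim_cofinite_inj: "inj f \<Longrightarrow> filterlim f cofinite cofinite"
  by (rule filterlim_cofinite_inj_on) auto

subsection \<open>Generic points\<close>

lemma real_polynomial_function_fst: "real_polynomial_function (\<lambda>z::real \<times> real. fst z)"
  and real_polynomial_function_snd: "real_polynomial_function (\<lambda>z::real \<times> real. snd z)"
  by (auto intro: real_polynomial_function.intros(1) bounded_linear_fst bounded_linear_snd)

lemma real_polynomial_function_sections:
  fixes D :: "real \<times> real \<Rightarrow> real"
  assumes "real_polynomial_function D"
  shows "real_polynomial_function (\<lambda>s. D (t, s))" "real_polynomial_function (\<lambda>t. D (t, s))"
proof -
  have "polynomial_function (\<lambda>s::real. (t, 0::real) + s *\<^sub>R (0, 1::real))"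
    "polynomial_function (\<lambda>t::real. (0::real, s) + t *\<^sub>R (1::real, 0))"
    by (intro polynomial_function_add polynomial_function_mult polynomial_function_const
        polynomial_function_id)+
  from this(1)[THEN real_polynomial_function_compose, OF assms]
    this(2)[THEN real_polynomial_function_compose, OF assms]
  show "real_polynomial_function (\<lambda>s. D (t, s))" "real_polynomial_function (\<lambda>t. D (t, s))"
    by (simp_all add: o_def)
qed

text \<open>On the horizontal line through \<open>z\<close> the polynomial has finitely many zeros;
  every vertical line through one of the other points again carries a polynomial that is not
  zero.\<close>

lemma real_polynomial_function_eventually_nonzero2:
  fixes D :: "real \<times> real \<Rightarrow> real"
  assumes D: "real_polynomial_function D" and nz: "D z \<noteq> 0"
  shows "\<forall>\<^sub>F t in cofinite. \<forall>\<^sub>F s in cofinite. D (t, s) \<noteq> 0"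
proof -
  obtain t0 s0 where z: "z = (t0, s0)" by (cases z)
  have "\<forall>\<^sub>F t in cofinite. D (t, s0) \<noteq> 0"
    using real_polynomial_function_eventually_nonzero[OF real_polynomial_function_sections(2)[OF D]]
      nz z by blast
  then show ?thesis
    by eventually_elim
      (use real_polynomial_function_eventually_nonzero[OF real_polynomial_function_sections(1)[OF D]]
        in blast)
qed

lemma generic_on_UNIV_imp_cofinite:
  fixes P :: "real \<times> real \<Rightarrow> bool"
  assumes "generic_on UNIV P"
  shows "\<forall>\<^sub>F t in cofinite. \<forall>\<^sub>F s in cofinite. P (t, s)"
proof -
  obtain D z where D: "real_polynomial_function D" "D z \<noteq> 0" "\<And>v. D v \<noteq> 0 \<Longrightarrow> P v"
    using assms unfolding generic_on_def by auto
  show ?thesis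
    using real_polynomial_function_eventually_nonzero2[OF D(1,2)]
    by eventually_elim (auto elim!: eventually_mono intro: D(3))
qed

lemma generic_on_mono: "generic_on V P \<Longrightarrow> (\<And>v. P v \<Longrightarrow> R v) \<Longrightarrow> generic_on V R"
  unfolding generic_on_def by blast

text \<open>Irreducibility of affine space, seen by restricting both polynomials to a line.\<close>
lemma generic_on_UNIV_conj:
  fixes P R :: "'a::euclidean_space \<Rightarrow> bool"
  assumes "generic_on UNIV P" "generic_on UNIV R"
  shows "generic_on UNIV (\<lambda>v. P v \<and> R v)"
proof -
  obtain D u where D: "real_polynomial_function D" "D u \<noteq> 0" "\<And>v. D v \<noteq> 0 \<Longrightarrow> P v"
    using assms(1) unfolding generic_on_def by auto
  obtain E w where E: "real_polynomial_function E" "E w \<noteq> 0" "\<And>v. E v \<noteq> 0 \<Longrightarrow> R v"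
    using assms(2) unfolding generic_on_def by auto
  let ?l = "\<lambda>r::real. u + r *\<^sub>R (w - u)"
  have l: "polynomial_function ?l"
    by (intro polynomial_function_add polynomial_function_mult polynomial_function_const
        polynomial_function_id)
  have "\<forall>\<^sub>F r in cofinite. D (?l r) \<noteq> 0"
    using real_polynomial_function_eventually_nonzero[of "D \<circ> ?l" 0] l D by auto
  moreover have "\<forall>\<^sub>F r in cofinite. E (?l r) \<noteq> 0"
    using real_polynomial_function_eventually_nonzero[of "E \<circ> ?l" 1] l E by auto
  ultimately have "\<forall>\<^sub>F r in cofinite. D (?l r) * E (?l r) \<noteq> 0" by eventually_elim simp
  then obtain r where "D (?l r) * E (?l r) \<noteq> 0" by (rule eventually_cofinite_realE)
  then show ?thesis
    unfolding generic_on_def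
    using D(1,3) E(1,3) by (intro exI[of _ "\<lambda>v. D v * E v"]) auto
qed

lemma rational_function_on_generic_cong:
  fixes h h' :: "'a::euclidean_space \<Rightarrow> real"
  assumes "rational_function_on UNIV h" "generic_on UNIV (\<lambda>v. h v = h' v)"
  shows "rational_function_on UNIV h'"
proof -
  obtain N D where ND: "real_polynomial_function N" "real_polynomial_function D" "\<exists>v. D v \<noteq> 0"
    "\<And>v. D v \<noteq> 0 \<Longrightarrow> h v = N v / D v"
    using assms(1) unfolding rational_function_on_def by auto
  have "generic_on UNIV (\<lambda>v. D v \<noteq> 0)" unfolding generic_on_def using ND by auto
  from generic_on_UNIV_conj[OF this assms(2)]
  obtain E where E: "real_polynomial_function E" "\<exists>v. E v \<noteq> 0"
    "\<And>v. E v \<noteq> 0 \<Longrightarrow> D v \<noteq> 0 \<and> h v = h' v" unfolding generic_on_def by auto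
  \<comment> \<open>Expanding the fraction by \<open>E\<close> shrinks the set where the denominator
    is nonzero to points where \<open>h\<close> and \<open>h'\<close> agree.\<close>
  show ?thesis unfolding rational_function_on_def
    using ND E
    by (intro exI[of _ "\<lambda>v. N v * E v"] exI[of _ "\<lambda>v. D v * E v"]) (auto dest: E(3))
qed

lemma rational_function_on_add:
  fixes h h' :: "'a::euclidean_space \<Rightarrow> real"
  assumes "rational_function_on UNIV h" "rational_function_on UNIV h'"
  shows "rational_function_on UNIV (\<lambda>v. h v + h' v)"
proof -
  obtain N D where ND: "real_polynomial_function N" "real_polynomial_function D" "\<exists>v. D v \<noteq> 0"
    "\<And>v. D v \<noteq> 0 \<Longrightarrow> h v = N v / D v"
    using assms(1) unfolding rational_function_on_def by auto
  obtain M E where ME: "real_polynomial_function M" "real_polynomial_function E" "\<exists>v. E v \<noteq> 0"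
    "\<And>v. E v \<noteq> 0 \<Longrightarrow> h' v = M v / E v"
    using assms(2) unfolding rational_function_on_def by auto
  have "generic_on UNIV (\<lambda>v. D v \<noteq> 0)" "generic_on UNIV (\<lambda>v. E v \<noteq> 0)"
    unfolding generic_on_def using ND ME by auto
  from generic_on_UNIV_conj[OF this] have ex: "\<exists>v. D v * E v \<noteq> 0"
    unfolding generic_on_def by auto
  show ?thesis unfolding rational_function_on_def
    using ND ME ex
    by (intro exI[of _ "\<lambda>v. N v * E v + M v * D v"] exI[of _ "\<lambda>v. D v * E v"])
      (auto simp: add_frac_eq)
qed

lemma rational_function_on_mult:
  fixes h h' :: "'a::euclidean_space \<Rightarrow> real"
  assumes "rational_function_on UNIV h" "rational_function_on UNIV h'"
  shows "rational_function_on UNIV (\<lambda>v. h v * h' v)"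
proof -
  obtain N D where ND: "real_polynomial_function N" "real_polynomial_function D" "\<exists>v. D v \<noteq> 0"
    "\<And>v. D v \<noteq> 0 \<Longrightarrow> h v = N v / D v"
    using assms(1) unfolding rational_function_on_def by auto
  obtain M E where ME: "real_polynomial_function M" "real_polynomial_function E" "\<exists>v. E v \<noteq> 0"
    "\<And>v. E v \<noteq> 0 \<Longrightarrow> h' v = M v / E v"
    using assms(2) unfolding rational_function_on_def by auto
  have "generic_on UNIV (\<lambda>v. D v \<noteq> 0)" "generic_on UNIV (\<lambda>v. E v \<noteq> 0)"
    unfolding generic_on_def using ND ME by auto
  from generic_on_UNIV_conj[OF this] have ex: "\<exists>v. D v * E v \<noteq> 0"
    unfolding generic_on_def by auto
  show ?thesis unfolding rational_function_on_def
    using ND ME ex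
    by (intro exI[of _ "\<lambda>v. N v * M v"] exI[of _ "\<lambda>v. D v * E v"]) auto
qed

lemma rational_function_on_polynomial:
  "real_polynomial_function h \<Longrightarrow> rational_function_on UNIV h"
  unfolding rational_function_on_def by (intro exI[of _ h] exI[of _ "\<lambda>_. 1"]) auto

lemma rational_function_on_divide_poly:
  fixes a b :: "real poly"
  assumes "b \<noteq> 0"
  shows "rational_function_on UNIV (\<lambda>z::real \<times> real. poly a (fst z) / poly b (fst z))"
proof -
  obtain t where "poly b t \<noteq> 0" using poly_eventually_nonzero[OF assms] eventually_cofinite_realE by blast
  then have "\<exists>z::real \<times> real. poly b (fst z) \<noteq> 0" by (intro exI[of _ "(t, 0)"]) simp
  then show ?thesis unfolding rational_function_on_def
    using real_polynomial_function_poly[OF real_polynomial_function_fst]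
    by (intro exI[of _ "\<lambda>z. poly a (fst z)"] exI[of _ "\<lambda>z. poly b (fst z)"]) auto
qed

lemma rational_function_on_sum:
  fixes h :: "'i \<Rightarrow> 'a::euclidean_space \<Rightarrow> real"
  assumes "finite I" "\<And>i. i \<in> I \<Longrightarrow> rational_function_on UNIV (h i)"
  shows "rational_function_on UNIV (\<lambda>v. \<Sum>i\<in>I. h i v)"
  using assms
  by (induction I rule: finite_induct)
    (auto intro: rational_function_on_polynomial rational_function_on_add)

text \<open>The way back from nested filters to \<open>generic_on\<close>: the cross-multiplied
  difference of the two fractions is a single polynomial, and if it were nonzero at one point it
  would be nonzero at almost all \<open>s\<close> for almost all \<open>t\<close>.\<close>

lemma rational_functions_generic_eqI:
  fixes h h' :: "real \<times> real \<Rightarrow> real"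
  assumes "rational_function_on UNIV h" "rational_function_on UNIV h'"
    and eq: "\<forall>\<^sub>F t in cofinite. \<forall>\<^sub>F s in cofinite. h (t, s) = h' (t, s)"
  shows "generic_on UNIV (\<lambda>v. h v = h' v)"
proof -
  obtain N D where ND: "real_polynomial_function N" "real_polynomial_function D" "\<exists>v. D v \<noteq> 0"
    "\<And>v. D v \<noteq> 0 \<Longrightarrow> h v = N v / D v"
    using assms(1) unfolding rational_function_on_def by auto
  obtain M E where ME: "real_polynomial_function M" "real_polynomial_function E" "\<exists>v. E v \<noteq> 0"
    "\<And>v. E v \<noteq> 0 \<Longrightarrow> h' v = M v / E v"
    using assms(2) unfolding rational_function_on_def by auto
  have gen: "generic_on UNIV (\<lambda>v. D v \<noteq> 0)" "generic_on UNIV (\<lambda>v. E v \<noteq> 0)"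
    unfolding generic_on_def using ND ME by auto
  define F where "F v = N v * E v - M v * D v" for v
  have F: "real_polynomial_function F" unfolding F_def using ND ME by auto
  have F0: "F z = 0" for z
  proof (rule ccontr)
    assume "F z \<noteq> 0"
    from real_polynomial_function_eventually_nonzero2[OF F this] eq
      generic_on_UNIV_imp_cofinite[OF generic_on_UNIV_conj[OF gen]]
    have "\<forall>\<^sub>F t::real in cofinite. \<forall>\<^sub>F s::real in cofinite. False"
    proof eventually_elim
      case (elim t)
      from elim show ?case
        by eventually_elim (auto simp: F_def ND(4) ME(4) field_simps)
    qed
    then show False by (simp add: infinite_UNIV_char_0)
  qed
  show ?thesis
    using generic_on_UNIV_conj[OF gen]
  proof (rule generic_on_mono)
    fix v assume v: "D v \<noteq> 0 \<and> E v \<noteq> 0"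
    then have "N v / D v = M v / E v" using F0[of v] by (simp add: F_def field_simps)
    then show "h v = h' v" using ND(4) ME(4) v by simp
  qed
qed

text \<open>Here \<open>s\<close> is the outer variable, so that one fixed \<open>s\<close> can be
  chosen for which the denominator is nonzero at almost all \<open>t\<close>.\<close>

lemma rational_function_on_cofinite_regular:
  fixes h :: "real \<times> real \<Rightarrow> real"
  assumes "rational_function_on UNIV h"
  obtains N D where "real_polynomial_function N" "real_polynomial_function D"
    "\<forall>\<^sub>F s in cofinite. \<forall>\<^sub>F t in cofinite. D (t, s) \<noteq> 0"
    "\<And>v. D v \<noteq> 0 \<Longrightarrow> h v = N v / D v"
proof -
  obtain N D z where ND: "real_polynomial_function N" "real_polynomial_function D" "D z \<noteq> 0"
    "\<And>v. D v \<noteq> 0 \<Longrightarrow> h v = N v / D v"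
    using assms(1) unfolding rational_function_on_def by auto
  have "\<forall>\<^sub>F s in cofinite. D (fst z, s) \<noteq> 0"
    using real_polynomial_function_eventually_nonzero[OF real_polynomial_function_sections(1)[OF ND(2)]]
      ND(3) by (metis prod.collapse)
  then have "\<forall>\<^sub>F s in cofinite. \<forall>\<^sub>F t in cofinite. D (t, s) \<noteq> 0"
    by eventually_elim
      (use real_polynomial_function_eventually_nonzero[OF real_polynomial_function_sections(2)[OF ND(2)]]
        in blast)
  with ND that show ?thesis by blast
qed

subsection \<open>Rational functions with a rational left inverse\<close>

text \<open>The exceptional set is any finite set, not tied to the zeros of \<open>v\<close>. This
  fits functions defined by choice and spares the bookkeeping of poles.\<close>

definition cofinitely_rational :: "(real \<Rightarrow> real) \<Rightarrow> bool" where
  "cofinitely_rational F \<longleftrightarrow>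
     (\<exists>u v. v \<noteq> 0 \<and> (\<forall>\<^sub>F t in cofinite. F t = poly u t / poly v t))"

section \<open>Closure properties of rational functions of one variable\<close>

lemma cofinitely_rationalI:
  "v \<noteq> 0 \<Longrightarrow> \<forall>\<^sub>F t in cofinite. F t = poly u t / poly v t \<Longrightarrow> cofinitely_rational F"
  unfolding cofinitely_rational_def by blast

lemma cofinitely_rational_poly: "cofinitely_rational (poly p)"
  by (rule cofinitely_rationalI[of 1 _ p]) auto

lemma cofinitely_rational_const: "cofinitely_rational (\<lambda>_. c)"
  by (rule cofinitely_rationalI[of 1 _ "[:c:]"]) auto

lemma cofinitely_rational_cong:
  assumes "cofinitely_rational F" "\<forall>\<^sub>F t in cofinite. F t = G t"
  shows "cofinitely_rational G"
proof -
  obtain u v where "v \<noteq> 0" and ev: "\<forall>\<^sub>F t in cofinite. F t = poly u t / poly v t"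
    using assms(1) unfolding cofinitely_rational_def by blast
  from ev assms(2) have "\<forall>\<^sub>F t in cofinite. G t = poly u t / poly v t"
    by eventually_elim simp
  with \<open>v \<noteq> 0\<close> show ?thesis by (rule cofinitely_rationalI)
qed

lemma cofinitely_rational_add:
  assumes "cofinitely_rational F" "cofinitely_rational G"
  shows "cofinitely_rational (\<lambda>t. F t + G t)"
proof -
  obtain u v where v: "v \<noteq> 0" and F: "\<forall>\<^sub>F t in cofinite. F t = poly u t / poly v t"
    using assms(1) unfolding cofinitely_rational_def by blast
  obtain a b where b: "b \<noteq> 0" and G: "\<forall>\<^sub>F t in cofinite. G t = poly a t / poly b t"
    using assms(2) unfolding cofinitely_rational_def by blast
  from F G poly_eventually_nonzero[OF v] poly_eventually_nonzero[OF b]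
  have "\<forall>\<^sub>F t in cofinite. F t + G t = poly (u * b + a * v) t / poly (v * b) t"
    by eventually_elim (simp add: add_frac_eq)
  then show ?thesis by (rule cofinitely_rationalI[rotated]) (use v b in simp)
qed

lemma cofinitely_rational_mult:
  assumes "cofinitely_rational F" "cofinitely_rational G"
  shows "cofinitely_rational (\<lambda>t. F t * G t)"
proof -
  obtain u v where v: "v \<noteq> 0" and F: "\<forall>\<^sub>F t in cofinite. F t = poly u t / poly v t"
    using assms(1) unfolding cofinitely_rational_def by blast
  obtain a b where b: "b \<noteq> 0" and G: "\<forall>\<^sub>F t in cofinite. G t = poly a t / poly b t"
    using assms(2) unfolding cofinitely_rational_def by blast
  from F G have "\<forall>\<^sub>F t in cofinite. F t * G t = poly (u * a) t / poly (v * b) t"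
    by eventually_elim simp
  then show ?thesis by (rule cofinitely_rationalI[rotated]) (use v b in simp)
qed

lemma cofinitely_rational_inverse:
  assumes "cofinitely_rational F"
  shows "cofinitely_rational (\<lambda>t. inverse (F t))"
proof -
  obtain u v where v: "v \<noteq> 0" and F: "\<forall>\<^sub>F t in cofinite. F t = poly u t / poly v t"
    using assms(1) unfolding cofinitely_rational_def by blast
  show ?thesis
  proof (cases "u = 0")
    case True
    \<comment> \<open>Since \<open>inverse 0 = 0\<close>, the reciprocal of the zero function is
      again constant.\<close>
    with F have "\<forall>\<^sub>F t in cofinite. 0 = inverse (F t)" by (auto elim!: eventually_mono)
    then show ?thesis by (rule cofinitely_rational_cong[OF cofinitely_rational_const])
  next
    case False
    have "\<forall>\<^sub>F t in cofinite. inverse (F t) = poly v t / poly u t"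
      using F by eventually_elim simp
    then show ?thesis using False by (intro cofinitely_rationalI)
  qed
qed

text \<open>The condition \<open>lim\<close> prevents \<open>F\<close> from hitting the exceptional
  points of \<open>G\<close> infinitely often, as a constant \<open>F\<close> could.\<close>

lemma cofinitely_rational_compose:
  assumes G: "cofinitely_rational G" and F: "cofinitely_rational F"
    and lim: "filterlim F cofinite cofinite"
  shows "cofinitely_rational (\<lambda>t. G (F t))"
proof -
  have poly: "cofinitely_rational (\<lambda>t. poly p (F t))" for p
    by (induction p) (auto intro!: cofinitely_rational_const cofinitely_rational_add
        cofinitely_rational_mult F)
  obtain u v where v: "v \<noteq> 0" and ev: "\<forall>\<^sub>F t in cofinite. G t = poly u t / poly v t"
    using G unfolding cofinitely_rational_def by blast
  have "\<forall>\<^sub>F t in cofinite. G (F t) = poly u (F t) / poly v (F t)"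
    by (rule eventually_compose_filterlim[OF ev lim])
  then have "\<forall>\<^sub>F t in cofinite. poly u (F t) * inverse (poly v (F t)) = G (F t)"
    by eventually_elim (simp add: divide_inverse)
  then show ?thesis
    by (rule cofinitely_rational_cong[rotated])
      (intro cofinitely_rational_mult cofinitely_rational_inverse poly)
qed

text \<open>The polynomial \<open>h\<close> is \<open>p (u / v)\<close> with denominators cleared.
  Because \<open>u\<close> has the larger degree, the leading term of \<open>p\<close> alone
  determines the degree of \<open>h\<close>; all other terms contain a factor \<open>v\<close>,
  which gives the congruence.\<close>

lemma homogenize_poly:
  fixes u v :: "real poly"
  assumes deg: "degree v < degree u" and "p \<noteq> 0"
  shows "\<exists>h. h \<noteq> 0 \<and> degree h = degree p * degree u \<and>
           v dvd h - smult (lead_coeff p) (u ^ degree p) \<and>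
           (\<forall>t. poly v t \<noteq> 0 \<longrightarrow> poly h t = poly v t ^ degree p * poly p (poly u t / poly v t))"
  using assms(2)
proof (induction p rule: pCons_induct)
  case 0
  then show ?case by simp
next
  case (pCons a p)
  show ?case
  proof (cases "p = 0")
    case True
    with pCons show ?thesis by (intro exI[of _ "[:a:]"]) auto
  next
    case False
    then obtain h where h: "h \<noteq> 0" "degree h = degree p * degree u"
      "v dvd h - smult (lead_coeff p) (u ^ degree p)"
      "\<And>t. poly v t \<noteq> 0 \<Longrightarrow> poly h t = poly v t ^ degree p * poly p (poly u t / poly v t)"
      using pCons.IH by blast
    \<comment> \<open>Horner step: \<open>a + x * p\<close> is homogenized in \<open>u\<close> and
      \<open>v\<close> to one degree higher than \<open>p\<close>.\<close>
    let ?h = "smult a (v ^ Suc (degree p)) + u * h"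
    have u: "u \<noteq> 0" using deg by auto
    have duh: "degree (u * h) = Suc (degree p) * degree u"
      using h u by (simp add: degree_mult_eq)
    have "degree (smult a (v ^ Suc (degree p))) \<le> degree v * Suc (degree p)"
      using degree_smult_le degree_power_le order.trans by blast
    also have "\<dots> < degree (u * h)" using deg 
      using mult_less_mono1[OF deg zero_less_Suc[of "degree p"]] unfolding duh
      by (simp only: mult.commute)
    finally have lt: "degree (smult a (v ^ Suc (degree p))) < degree (u * h)" .
    then have dh: "degree ?h = degree (u * h)" by (rule degree_add_eq_right)
    then have "?h \<noteq> 0" using lt by auto
    moreover have "degree ?h = degree (pCons a p) * degree u"
      using dh duh False by simp
    moreover have "v dvd ?h - smult (lead_coeff (pCons a p)) (u ^ degree (pCons a p))"
    proof -
      have eq: "?h - smult (lead_coeff (pCons a p)) (u ^ degree (pCons a p)) =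
        v * smult a (v ^ degree p) + u * (h - smult (lead_coeff p) (u ^ degree p))"
        using False by (simp add: algebra_simps)
      show ?thesis
        unfolding eq by (intro dvd_add dvd_triv_left dvd_mult h(3))
    qed
    moreover have "poly ?h t = poly v t ^ degree (pCons a p) * poly (pCons a p) (poly u t / poly v t)"
      if "poly v t \<noteq> 0" for t
    proof -
      define x where "x = poly u t / poly v t"
      have u: "poly u t = poly v t * x" using that by (simp add: x_def)
      have "poly h t = poly v t ^ degree p * poly p x" using h(4)[OF that] by (simp add: x_def)
      then show ?thesis using False unfolding x_def[symmetric]
        by (simp add: poly_power u algebra_simps)
    qed
    ultimately show ?thesis by blast
  qed
qed

text \<open>
  At infinity the function grows like the power \<open>degree u - degree v\<close> and its left inverse like
  \<open>degree u' - degree v'\<close>; the product of these integers is 1.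
\<close>
lemma degree_of_left_invertible:
  fixes u v u' v' :: "real poly"
  assumes coprime: "coprime u v" and deg: "degree v < degree u" and v': "v' \<noteq> 0"
    and lim: "filterlim (\<lambda>t. poly u t / poly v t) cofinite cofinite"
    and left_inv: "\<forall>\<^sub>F t in cofinite. poly u' (poly u t / poly v t) = t * poly v' (poly u t / poly v t)"
  shows "degree u = 1 \<and> degree v = 0"
proof -
  let ?F = "\<lambda>t. poly u t / poly v t"
  have "v \<noteq> 0"
  proof
    \<comment> \<open>Division by zero makes the quotient constantly 0, which \<open>lim\<close>
      forbids.\<close>
    assume "v = 0"
    with eventually_compose_filterlim[OF eventually_cofinite_neq[of 0] lim]
    have "\<forall>\<^sub>F t::real in cofinite. (0::real) \<noteq> 0" by simp
    then show False by (simp add: infinite_UNIV_char_0)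
  qed
  have v'F: "\<forall>\<^sub>F t in cofinite. poly v' (?F t) \<noteq> 0"
    by (rule eventually_compose_filterlim[OF poly_eventually_nonzero[OF v'] lim])
  have "u' \<noteq> 0"
  proof
    assume "u' = 0"
    from left_inv v'F eventually_cofinite_neq[of "0::real"] have "\<forall>\<^sub>F t::real in cofinite. False"
      by eventually_elim (use \<open>u' = 0\<close> in auto)
    then show False by (simp add: infinite_UNIV_char_0)
  qed
  obtain h where h: "h \<noteq> 0" "degree h = degree u' * degree u"
      "v dvd h - smult (lead_coeff u') (u ^ degree u')"
      "\<And>t. poly v t \<noteq> 0 \<Longrightarrow> poly h t = poly v t ^ degree u' * poly u' (?F t)"
    using homogenize_poly[OF deg \<open>u' \<noteq> 0\<close>] by blast
  obtain k where k: "k \<noteq> 0" "degree k = degree v' * degree u"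
      "\<And>t. poly v t \<noteq> 0 \<Longrightarrow> poly k t = poly v t ^ degree v' * poly v' (?F t)"
    using homogenize_poly[OF deg \<open>v' \<noteq> 0\<close>] by blast
  \<comment> \<open>Multiplying \<open>left_inv\<close> by
    \<open>v ^ (degree u' + degree v')\<close> makes it an identity of polynomials, whose degrees
    can be compared.\<close>
  from left_inv poly_eventually_nonzero[OF \<open>v \<noteq> 0\<close>]
  have "\<forall>\<^sub>F t in cofinite. poly (v ^ degree v' * h) t = poly ([:0, 1:] * v ^ degree u' * k) t"
    by eventually_elim (simp add: h(4) k(3))
  then have id: "v ^ degree v' * h = [:0, 1:] * v ^ degree u' * k"
    by (rule poly_eqI_cofinite)
  have "degree (v ^ degree v' * h) = degree v' * degree v + degree u' * degree u"
    using h \<open>v \<noteq> 0\<close> by (simp add: degree_mult_eq degree_power_eq)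
  moreover have "degree ([:0, 1:] * v ^ degree u' * k) = 1 + degree u' * degree v + degree v' * degree u"
    using k \<open>v \<noteq> 0\<close> by (simp add: degree_mult_eq degree_power_eq del: mult_pCons_left)
  ultimately have eq: "degree v' * degree v + degree u' * degree u =
      1 + degree u' * degree v + degree v' * degree u" using id by simp
  \<comment> \<open>Integers are used because \<open>degree u' - degree v'\<close> is not yet known
    to be nonnegative. The other factor is positive by \<open>deg\<close>, so both factors are
    1.\<close>
  have "int (degree v') * int (degree v) + int (degree u') * int (degree u) =
      1 + int (degree u') * int (degree v) + int (degree v') * int (degree u)"
    using arg_cong[OF eq, of int] by simp
  then have "(int (degree u') - int (degree v')) * (int (degree u) - int (degree v)) = 1"
    by (simp add: algebra_simps)
  then have "int (degree u') - int (degree v') = 1" "int (degree u) - int (degree v) = 1"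
    using deg by (auto simp: zmult_eq_1_iff)
  then have e: "degree u' = Suc (degree v')" and d: "degree u = Suc (degree v)" by linarith+
  \<comment> \<open>The exponents of \<open>v\<close> on the two sides differ by one, so
    \<open>v\<close> divides \<open>h\<close>. Modulo \<open>v\<close>, however, \<open>h\<close> is
    a constant multiple of a power of \<open>u\<close>, and \<open>u\<close> is coprime to
    \<open>v\<close>.\<close>
  have "v ^ degree v' * h = v ^ degree v' * (v * ([:0, 1:] * k))"
    using id by (simp only: e power_Suc ac_simps)
  then have "h = v * ([:0, 1:] * k)"
    using \<open>v \<noteq> 0\<close> by (simp only: mult_cancel_left power_eq_0_iff) simp
  then have "v dvd h" by (metis dvd_triv_left)
  then have "v dvd smult (lead_coeff u') (u ^ degree u')"
    using h(3) by (metis dvd_diff_commute dvd_diff_right_iff)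
  then have "v dvd u ^ degree u'" using \<open>u' \<noteq> 0\<close> by (simp add: dvd_smult_iff)
  moreover have "coprime v (u ^ degree u')" using coprime by (simp add: coprime_commute)
  ultimately have "is_unit v" using coprime_common_divisor[of v "u ^ degree u'" v] by simp
  then have "degree v = 0" using is_unit_iff_degree[OF \<open>v \<noteq> 0\<close>] by simp
  with d show ?thesis by simp
qed

text \<open>After composing with a Moebius transformation the function has a pole at infinity.\<close>
lemma moebius_of_left_invertible:
  assumes F: "cofinitely_rational F" and G: "cofinitely_rational G"
    and lim: "filterlim F cofinite cofinite"
    and left_inv: "\<forall>\<^sub>F t in cofinite. G (F t) = t"
  obtains \<alpha> \<beta> \<gamma> \<delta> where "\<alpha> * \<delta> - \<beta> * \<gamma> \<noteq> 0"
    "\<forall>\<^sub>F t in cofinite. F t = (\<alpha> * t + \<beta>) / (\<gamma> * t + \<delta>)"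
proof -
  \<comment> \<open>The case of a pole at infinity is stated for arbitrary \<open>F\<close> and
    \<open>G\<close>, since it is applied both to the given function and to its Moebius transform
    \<open>1 / (F - l)\<close>.\<close>
  have affine: "\<exists>\<alpha> \<beta>. \<alpha> \<noteq> 0 \<and> (\<forall>\<^sub>F t in cofinite. F t = \<alpha> * t + \<beta>)"
    if G: "cofinitely_rational G" and lim: "filterlim F cofinite cofinite"
    and left_inv: "\<forall>\<^sub>F t in cofinite. G (F t) = t"
    and ab: "coprime a b" "degree b < degree a" "\<forall>\<^sub>F t in cofinite. F t = poly a t / poly b t"
    for F G a b
  proof -
    obtain u v where v: "v \<noteq> 0" and ev: "\<forall>\<^sub>F t in cofinite. G t = poly u t / poly v t"
      using G unfolding cofinitely_rational_def by blast
    have "\<forall>\<^sub>F t in cofinite. G (F t) = poly u (F t) / poly v (F t)"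
      "\<forall>\<^sub>F t in cofinite. poly v (F t) \<noteq> 0"
      by (rule eventually_compose_filterlim[OF _ lim], rule ev poly_eventually_nonzero[OF v])+
    with left_inv ab(3)
    have "\<forall>\<^sub>F t in cofinite. poly u (poly a t / poly b t) = t * poly v (poly a t / poly b t)"
      by eventually_elim (auto simp: field_simps)
    moreover have "filterlim (\<lambda>t. poly a t / poly b t) cofinite cofinite"
      using lim ab(3) by (rule filterlim_mono_eventually[OF _ order.refl order.refl])
    ultimately have dg: "degree a = 1" "degree b = 0"
      using degree_of_left_invertible[OF ab(1,2) v] by blast+
    obtain c where b: "b = [:c:]" using dg(2) degree_eq_zeroE by blast
    define d e where "d = coeff a 1" and "e = coeff a 0"
    have a: "a = [:e, d:]"
      by (rule poly_eqI) (auto simp: d_def e_def coeff_pCons coeff_eq_0 dg split: nat.split)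
    have d: "d \<noteq> 0" using a dg by auto
    have "c \<noteq> 0"
    proof
      assume "c = 0"
      with ab(1) b have "is_unit a" by simp
      then show False using dg(1) by (simp add: is_unit_iff_degree a d)
    qed
    have "\<forall>\<^sub>F t in cofinite. F t = d / c * t + e / c"
      using ab(3) by eventually_elim (simp add: a b add_divide_distrib)
    then show ?thesis using d \<open>c \<noteq> 0\<close> by (intro exI[of _ "d / c"] exI[of _ "e / c"]) simp
  qed
  obtain u v where v: "v \<noteq> 0" and ev: "\<forall>\<^sub>F t in cofinite. F t = poly u t / poly v t"
    using F unfolding cofinitely_rational_def by blast
  obtain a b where ab: "u = a * gcd u v" "v = b * gcd u v" "coprime a b"
    using gcd_coprime_exists[of u v] v by auto
  have "gcd u v \<noteq> 0" "b \<noteq> 0" using v ab(2) by auto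
  have Fab: "\<forall>\<^sub>F t in cofinite. F t = poly a t / poly b t"
    using ev poly_eventually_nonzero[OF \<open>gcd u v \<noteq> 0\<close>]
  proof eventually_elim
    case (elim t)
    have "poly u t = poly a t * poly (gcd u v) t" "poly v t = poly b t * poly (gcd u v) t"
      using arg_cong[OF ab(1), of "\<lambda>p. poly p t"] arg_cong[OF ab(2), of "\<lambda>p. poly p t"]
      by (simp_all only: poly_mult)
    with elim show ?case by simp
  qed
  show ?thesis
  proof (cases "degree b < degree a")
    case True
    then obtain \<alpha> \<beta> where "\<alpha> \<noteq> 0" "\<forall>\<^sub>F t in cofinite. F t = \<alpha> * t + \<beta>"
      using affine[OF G lim left_inv ab(3) True Fab] by blast
    then show ?thesis by (intro that[of \<alpha> 1 \<beta> 0]) auto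
  next
    case False
    \<comment> \<open>\<open>l\<close> is the value of \<open>F\<close> at infinity (0 if
      \<open>degree a < degree b\<close>), and \<open>r\<close> is the numerator of
      \<open>F - l\<close>; thus \<open>1 / (F - l)\<close> has its pole at infinity.\<close>
    define l where "l = coeff a (degree b) / lead_coeff b"
    define r where "r = a - smult l b"
    have "r \<noteq> 0"
    proof
      assume "r = 0"
      then have a: "a = smult l b" by (simp add: r_def)
      from Fab poly_eventually_nonzero[OF \<open>b \<noteq> 0\<close>] have "\<forall>\<^sub>F t in cofinite. F t = l"
        by eventually_elim (simp add: a)
      moreover have "\<forall>\<^sub>F t in cofinite. F t \<noteq> l"
        by (rule eventually_compose_filterlim[OF eventually_cofinite_neq lim])
      ultimately have "\<forall>\<^sub>F t::real in cofinite. False" by eventually_elim simp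
      then show False by (simp add: infinite_UNIV_char_0)
    qed
    have "degree r \<le> degree b"
      unfolding r_def using False by (intro degree_diff_le) auto
    moreover have "coeff r (degree b) = 0"
      using \<open>b \<noteq> 0\<close> by (simp add: r_def l_def)
    ultimately have degr: "degree r < degree b"
      using \<open>r \<noteq> 0\<close> by (metis leading_coeff_0_iff order_le_less)
    have "coprime b r"
    proof (rule coprimeI)
      fix c assume "c dvd b" "c dvd r"
      then have "c dvd a" by (simp add: r_def dvd_diff_left_iff dvd_smult)
      with \<open>c dvd b\<close> show "is_unit c" using ab(3) coprime_common_divisor by blast
    qed
    let ?F = "\<lambda>t. 1 / (F t - l)" and ?G = "\<lambda>y. G (l + 1 / y)"
    \<comment> \<open>With \<open>1 / 0 = 0\<close> this map is injective on all reals: the value 0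
      is taken only at \<open>l\<close>. The same convention serves the inverse map below.\<close>
    have "inj (\<lambda>y::real. 1 / (y - l))" by (auto simp: inj_on_def divide_inverse)
    then have limF: "filterlim ?F cofinite cofinite"
      using filterlim_compose[OF filterlim_cofinite_inj lim] by blast
    have "inj (\<lambda>y::real. l + 1 / y)" by (auto simp: inj_on_def divide_inverse)
    then have G': "cofinitely_rational ?G"
    proof (intro cofinitely_rational_compose[OF G] filterlim_cofinite_inj)
      have "cofinitely_rational (\<lambda>y. l + inverse (poly [:0, 1:] y))"
        by (intro cofinitely_rational_add cofinitely_rational_const cofinitely_rational_inverse
            cofinitely_rational_poly)
      then show "cofinitely_rational (\<lambda>y. l + 1 / y)" by (simp add: divide_inverse)
    qed
    have neq: "\<forall>\<^sub>F t in cofinite. F t \<noteq> l"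
      by (rule eventually_compose_filterlim[OF eventually_cofinite_neq lim])
    then have "\<forall>\<^sub>F t in cofinite. ?G (?F t) = t"
      using left_inv by eventually_elim simp
    moreover from Fab poly_eventually_nonzero[OF \<open>b \<noteq> 0\<close>]
    have "\<forall>\<^sub>F t in cofinite. ?F t = poly b t / poly r t"
    proof eventually_elim
      case (elim t)
      then have "F t - l = poly r t / poly b t" by (simp add: r_def field_simps)
      then show ?case by simp
    qed
    ultimately obtain \<alpha> \<beta> where "\<alpha> \<noteq> 0" and F': "\<forall>\<^sub>F t in cofinite. ?F t = \<alpha> * t + \<beta>"
      using affine[OF G' limF _ \<open>coprime b r\<close> degr] by blast
    from F' neq have "\<forall>\<^sub>F t in cofinite. F t = (l * \<alpha> * t + (l * \<beta> + 1)) / (\<alpha> * t + \<beta>)"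
    proof eventually_elim
      case (elim t)
      then have "\<alpha> * t + \<beta> \<noteq> 0" by (metis divide_eq_0_iff right_minus_eq zero_neq_one)
      moreover have "(F t - l) * (\<alpha> * t + \<beta>) = 1" using elim by (metis nonzero_divide_eq_eq right_minus_eq mult.commute)
      ultimately show ?case by (simp add: field_simps)
    qed
    \<comment> \<open>The instantiation is in the order \<alpha>, \<delta>, \<beta>, \<gamma>; the
      determinant equals \<open>- \<alpha>\<close>.\<close>
    then show ?thesis using \<open>\<alpha> \<noteq> 0\<close> by (intro that[of "l * \<alpha>" \<beta> "l * \<beta> + 1" \<alpha>]) (auto simp: algebra_simps)
  qed
qed

subsection \<open>Evaluation of rational functions\<close>

text \<open>The reduced denominator divides every other denominator of the same fraction, so
  evaluation may use any representative whose denominator does not vanish.\<close>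

lemma rat_eval_Fract:
  assumes b: "poly b t \<noteq> 0"
  shows "regular_at (Fract a b) t" "rat_eval (Fract a b) t = poly a t / poly b t"
proof -
  define c d where "c = fst (quot_of_fract (Fract a b))" and "d = snd (quot_of_fract (Fract a b))"
  have "d \<noteq> 0" "b \<noteq> 0" using b by (auto simp: d_def)
  have "Fract c d = Fract a b" by (simp add: c_def d_def)
  then have eq: "c * b = a * d" using \<open>d \<noteq> 0\<close> \<open>b \<noteq> 0\<close> by (simp add: eq_fract)
  have "coprime d c" unfolding c_def d_def by (simp add: coprime_quot_of_fract coprime_commute)
  moreover have "d dvd c * b" by (simp add: eq)
  ultimately have "d dvd b" by (simp add: coprime_dvd_mult_right_iff)
  then have dt: "poly d t \<noteq> 0" using b by (auto elim!: dvdE)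
  then show "regular_at (Fract a b) t" by (simp add: regular_at_def d_def)
  have "poly c t * poly b t = poly a t * poly d t" using arg_cong[OF eq, of "\<lambda>p. poly p t"] by simp
  then show "rat_eval (Fract a b) t = poly a t / poly b t"
    using dt b by (simp add: rat_eval_def c_def[symmetric] d_def[symmetric] field_simps)
qed

lemma rat_eval_add:
  assumes "regular_at r t" "regular_at r' t"
  shows "regular_at (r + r') t" "rat_eval (r + r') t = rat_eval r t + rat_eval r' t"
proof -
  define a b c d where "a = fst (quot_of_fract r)" "b = snd (quot_of_fract r)"
    "c = fst (quot_of_fract r')" "d = snd (quot_of_fract r')"
  note defs = this
  have nz: "poly b t \<noteq> 0" "poly d t \<noteq> 0" using assms by (simp_all add: regular_at_def defs)
  then have "r + r' = Fract (a * d + c * b) (b * d)"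
    by (metis Fract_quot_of_fract add_fract defs poly_0)
  moreover have "poly (b * d) t \<noteq> 0" using nz by simp
  ultimately show "regular_at (r + r') t" "rat_eval (r + r') t = rat_eval r t + rat_eval r' t"
    using nz by (simp_all add: rat_eval_Fract rat_eval_def[of r] rat_eval_def[of r']
        defs[symmetric] add_frac_eq)
qed

lemma rat_eval_const [simp]:
  "regular_at (Fract [:x:] 1) t" "rat_eval (Fract [:x:] 1) t = x"
  by (simp_all add: rat_eval_Fract)

lemma rat_eval_const_mult:
  assumes "regular_at r t"
  shows "regular_at (Fract [:x:] 1 * r) t" "rat_eval (Fract [:x:] 1 * r) t = x * rat_eval r t"
proof -
  define a b where "a = fst (quot_of_fract r)" "b = snd (quot_of_fract r)"
  note defs = this
  have nz: "poly b t \<noteq> 0" using assms by (simp add: regular_at_def defs)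
  have "Fract [:x:] 1 * r = Fract [:x:] 1 * Fract a b" by (simp add: defs)
  also have "\<dots> = Fract ([:x:] * a) b" by (simp del: mult_pCons_left)
  finally show "regular_at (Fract [:x:] 1 * r) t" "rat_eval (Fract [:x:] 1 * r) t = x * rat_eval r t"
    using nz by (simp_all add: rat_eval_Fract rat_eval_def[of r] defs[symmetric])
qed

lemma rat_eval_sum:
  assumes "finite I" "\<And>i. i \<in> I \<Longrightarrow> regular_at (r i) t"
  shows "regular_at (\<Sum>i\<in>I. r i) t \<and> rat_eval (\<Sum>i\<in>I. r i) t = (\<Sum>i\<in>I. rat_eval (r i) t)"
  using assms
proof (induction I rule: finite_induct)
  case empty
  then show ?case by (simp add: regular_at_def rat_eval_def)
next
  case (insert i I)
  then show ?case by (simp add: rat_eval_add)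
qed

lemma regular_at_cofinite: "\<forall>\<^sub>F t in cofinite. regular_at r t"
  unfolding regular_at_def by (intro poly_eventually_nonzero snd_quot_of_fract_nonzero)

lemma ruled_dom_cofinite: "\<forall>\<^sub>F t in cofinite. t \<in> ruled_dom p"
  unfolding ruled_dom_def by (simp add: eventually_all_finite regular_at_cofinite)

lemma generic_on_fst:
  fixes P :: "real \<Rightarrow> bool"
  assumes "\<forall>\<^sub>F t in cofinite. P t"
  shows "generic_on UNIV (\<lambda>z::real \<times> real. P (fst z))"
proof -
  have fin: "finite {t. \<not> P t}" using assms by (simp add: eventually_cofinite)
  \<comment> \<open>One linear factor for each exceptional parameter: \<open>D\<close> vanishes
    exactly on the exceptional vertical lines.\<close>
  define D where "D z = (\<Prod>t\<in>{t. \<not> P t}. (fst z - t))" for z :: "real \<times> real"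
  have "real_polynomial_function D" unfolding D_def
    using fin by (intro real_polynomial_function_prod real_polynomial_function_diff real_polynomial_function_fst)
      auto
  moreover have "D z \<noteq> 0 \<longleftrightarrow> P (fst z)" for z unfolding D_def using fin by auto
  moreover obtain t where "P t" using assms eventually_cofinite_realE by blast
  ultimately show ?thesis unfolding generic_on_def by (metis UNIV_I fst_conv)
qed

subsection \<open>Moving a parametrization by a symmetry\<close>

text \<open>The base curve \<open>Q p + b\<close> of the moved surface, with real constants embedded
  in the fraction field as \<open>Fract [:x:] 1\<close>; its directions are given by
  \<open>linear_poly\<close>.\<close>

definition affine_fract :: "real ^ 3 ^ 3 \<Rightarrow> real ^ 3 \<Rightarrow> real poly fract ^ 3 \<Rightarrow> real poly fract ^ 3" where
  "affine_fract Q b p = (\<chi> i. (\<Sum>j\<in>UNIV. Fract [:Q $ i $ j:] 1 * p $ j) + Fract [:b $ i:] 1)"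

definition linear_poly :: "real ^ 3 ^ 3 \<Rightarrow> real poly ^ 3 \<Rightarrow> real poly ^ 3" where
  "linear_poly Q q = (\<chi> i. \<Sum>j\<in>UNIV. smult (Q $ i $ j) (q $ j))"

lemma poly_linear_poly: "(\<chi> i. poly (linear_poly Q q $ i) t) = Q *v (\<chi> i. poly (q $ i) t)"
  by (simp add: linear_poly_def matrix_vector_mult_def poly_sum)

lemma affine_fract_eval:
  assumes "t \<in> ruled_dom p"
  shows "t \<in> ruled_dom (affine_fract Q b p)"
    "(\<chi> i. rat_eval (affine_fract Q b p $ i) t) = Q *v (\<chi> i. rat_eval (p $ i) t) + b"
proof -
  have reg: "regular_at (Fract [:Q $ i $ j:] 1 * p $ j) t" for i j
    using assms by (simp add: ruled_dom_def rat_eval_const_mult)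
  note sum = rat_eval_sum[of "UNIV :: 3 set", OF _ reg]
  show "t \<in> ruled_dom (affine_fract Q b p)"
    using sum by (simp add: ruled_dom_def affine_fract_def rat_eval_add)
  show "(\<chi> i. rat_eval (affine_fract Q b p $ i) t) = Q *v (\<chi> i. rat_eval (p $ i) t) + b"
    using assms sum
    by (simp add: vec_eq_iff affine_fract_def rat_eval_add rat_eval_const_mult
        matrix_vector_mult_def ruled_dom_def)
qed

lemma ruled_map_affine:
  assumes "t \<in> ruled_dom p"
  shows "ruled_map (affine_fract Q b p) (linear_poly Q q) (t, s) = Q *v ruled_map p q (t, s) + b"
  using affine_fract_eval(2)[OF assms]
  by (simp add: ruled_map_def poly_linear_poly matrix_vector_right_distrib
      matrix_vector_mult_scaleR)

text \<open>The columns of \<open>Q\<close> are orthonormal, and the embedding \<open>C\<close> of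
  the reals is a ring homomorphism. This yields the reverse inclusion in
  \<open>ruled_dom_affine\<close>: the motion cancels no poles.\<close>

lemma affine_fract_inverse:
  assumes "orthogonal_matrix Q"
  shows "affine_fract (transpose Q) (- (transpose Q *v b)) (affine_fract Q b p) = p"
proof -
  define C where "C x = Fract [:x:] (1 :: real poly)" for x
  have C: "C (x + y) = C x + C y" "C (x * y) = C x * C y" "C 0 = 0" "C 1 = 1" "C (- x) = - C x" for x y
    by (simp_all add: C_def Zero_fract_def One_fract_def one_pCons mult.commute)
  have Csum: "C (sum f I) = (\<Sum>i\<in>I. C (f i))" if "finite I" for f :: "3 \<Rightarrow> real" and I
    using that by (induction I rule: finite_induct) (simp_all add: C)
  have QQ: "(\<Sum>i\<in>UNIV. Q $ i $ k * Q $ i $ j) = (if k = j then 1 else 0)" for j k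
    using assms unfolding orthogonal_matrix_def
    by (auto simp: matrix_matrix_mult_def transpose_def mat_def vec_eq_iff)
  have "(\<Sum>i\<in>UNIV. C (Q $ i $ k) * ((\<Sum>j\<in>UNIV. C (Q $ i $ j) * p $ j) + C (b $ i)))
      + C (- (\<Sum>i\<in>UNIV. Q $ i $ k * b $ i)) = p $ k" (is "?l = _") for k
  proof -
    have "?l = (\<Sum>i\<in>UNIV. \<Sum>j\<in>UNIV. C (Q $ i $ k * Q $ i $ j) * p $ j)"
      by (simp add: C Csum distrib_left sum.distrib sum_distrib_left mult.assoc)
    also have "\<dots> = (\<Sum>j\<in>UNIV. C (\<Sum>i\<in>UNIV. Q $ i $ k * Q $ i $ j) * p $ j)"
      by (subst sum.swap) (simp add: Csum sum_distrib_right)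
    also have "\<dots> = p $ k"
      by (simp add: QQ C if_distrib[of C] if_distrib[of "\<lambda>x. x * _"] cong: if_cong)
    finally show ?thesis .
  qed
  then show ?thesis
    by (simp add: vec_eq_iff affine_fract_def matrix_vector_mult_def transpose_def C_def)
qed

lemma ruled_dom_affine:
  assumes "orthogonal_matrix Q"
  shows "ruled_dom (affine_fract Q b p) = ruled_dom p"
  using affine_fract_eval(1)[of _ p Q b]
    affine_fract_eval(1)[of _ "affine_fract Q b p" "transpose Q" "- (transpose Q *v b)"]
    affine_fract_inverse[OF assms, of b p] by auto

section \<open>Pullback of generic properties and composition of birational maps\<close>

lemma rational_function_on_compose_poly:
  fixes h :: "'a::euclidean_space \<Rightarrow> 'b::euclidean_space"
  assumes "real_polynomial_function P" "\<And>e. e \<in> Basis \<Longrightarrow> rational_function_on UNIV (\<lambda>v. h v \<bullet> e)"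
  shows "rational_function_on UNIV (\<lambda>v. P (h v))"
  using assms(1)
proof (induction P rule: real_polynomial_function.induct)
  case (linear f)
  interpret bounded_linear f by fact
  have "f (h v) = (\<Sum>e\<in>Basis. (h v \<bullet> e) * f e)" for v
    by (subst euclidean_representation[of "h v", symmetric]) (simp add: sum scale)
  then have eq: "(\<lambda>v. f (h v)) = (\<lambda>v. \<Sum>e\<in>Basis. (h v \<bullet> e) * f e)" by (rule ext)
  show ?case
    unfolding eq by (intro rational_function_on_sum rational_function_on_mult assms(2)
        rational_function_on_polynomial real_polynomial_function.intros(2)) simp_all
qed (auto intro: rational_function_on_polynomial rational_function_on_add rational_function_on_mult)

text \<open>\<open>P\<close> is controlled only on \<open>W\<close>. Keeping
  \<open>h v \<in> W\<close> as a premise avoids intersecting two generic conditions on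
  \<open>V\<close>, which may be reducible.\<close>

lemma dominant_pullback:
  fixes h :: "'a::euclidean_space \<Rightarrow> 'b::euclidean_space"
  assumes dom: "dominant_rational_map V W h" and P: "generic_on W P"
  shows "generic_on V (\<lambda>v. h v \<in> W \<longrightarrow> P (h v))"
proof -
  obtain D where D: "real_polynomial_function D" "\<exists>w\<in>W. D w \<noteq> 0" "\<And>w. w \<in> W \<Longrightarrow> D w \<noteq> 0 \<Longrightarrow> P w"
    using P unfolding generic_on_def by blast
  then have "generic_on V (\<lambda>v. D (h v) \<noteq> 0)" using dom unfolding dominant_rational_map_def by blast
  then show ?thesis by (rule generic_on_mono) (use D(3) in blast)
qed

text \<open>A set dominated by affine space behaves as irreducible: both nonvanishing conditions are
  pulled back to affine space, met there simultaneously, and the image of such a point serves in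
  \<open>W\<close>.\<close>

lemma generic_on_dominated_conj:
  assumes dom: "dominant_rational_map UNIV W h" and P: "generic_on W P" and R: "generic_on W R"
  shows "generic_on W (\<lambda>w. P w \<and> R w)"
proof -
  obtain D where D: "real_polynomial_function D" "\<exists>w\<in>W. D w \<noteq> 0" "\<And>w. w \<in> W \<Longrightarrow> D w \<noteq> 0 \<Longrightarrow> P w"
    using P unfolding generic_on_def by blast
  obtain E where E: "real_polynomial_function E" "\<exists>w\<in>W. E w \<noteq> 0" "\<And>w. w \<in> W \<Longrightarrow> E w \<noteq> 0 \<Longrightarrow> R w"
    using R unfolding generic_on_def by blast
  have "generic_on UNIV (\<lambda>v. D (h v) \<noteq> 0)" "generic_on UNIV (\<lambda>v. E (h v) \<noteq> 0)"
    "generic_on UNIV (\<lambda>v. h v \<in> W)"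
    using dom D E unfolding dominant_rational_map_def by blast+
  then have "generic_on UNIV (\<lambda>v. (D (h v) \<noteq> 0 \<and> E (h v) \<noteq> 0) \<and> h v \<in> W)"
    by (intro generic_on_UNIV_conj)
  then obtain v where "D (h v) \<noteq> 0" "E (h v) \<noteq> 0" "h v \<in> W"
    unfolding generic_on_def by auto
  then show ?thesis unfolding generic_on_def
    using D E by (intro exI[of _ "\<lambda>w. D w * E w"]) auto
qed

text \<open>Evaluation at poles gives junk values, so the moved parametrization equals
  \<open>f\<close> after the original one only generically; birationality has to survive this
  change.\<close>

lemma birational_map_cong:
  assumes bir: "birational_map UNIV S h" and eq: "generic_on UNIV (\<lambda>v. h v = h' v)"
  shows "birational_map UNIV S h'"
proof -
  obtain g where dom: "dominant_rational_map UNIV S h" and g: "dominant_rational_map S UNIV g"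
    and gh: "generic_on UNIV (\<lambda>v. g (h v) = v)" and hg: "generic_on S (\<lambda>w. h (g w) = w)"
    using bir unfolding birational_map_def by blast
  have "dominant_rational_map UNIV S h'"
    unfolding dominant_rational_map_def
  proof (intro conjI ballI allI impI)
    fix e :: 'b assume "e \<in> Basis"
    then have "rational_function_on UNIV (\<lambda>v. h v \<bullet> e)"
      using dom unfolding dominant_rational_map_def by blast
    then show "rational_function_on UNIV (\<lambda>v. h' v \<bullet> e)"
      by (rule rational_function_on_generic_cong) (rule generic_on_mono[OF eq], simp)
  next
    have "generic_on UNIV (\<lambda>v. h v \<in> S)" using dom unfolding dominant_rational_map_def by blast
    from generic_on_UNIV_conj[OF this eq] show "generic_on UNIV (\<lambda>v. h' v \<in> S)"
      by (rule generic_on_mono) auto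
  next
    fix D :: "'b \<Rightarrow> real" assume "real_polynomial_function D" "\<exists>w\<in>S. D w \<noteq> 0"
    then have "generic_on UNIV (\<lambda>v. D (h v) \<noteq> 0)"
      using dom unfolding dominant_rational_map_def by blast
    from generic_on_UNIV_conj[OF this eq] show "generic_on UNIV (\<lambda>v. D (h' v) \<noteq> 0)"
      by (rule generic_on_mono) auto
  qed
  moreover have "generic_on UNIV (\<lambda>v. g (h' v) = v)"
    using generic_on_UNIV_conj[OF gh eq] by (rule generic_on_mono) auto
  \<comment> \<open>The equality of \<open>h\<close> and \<open>h'\<close> is required at the points
    \<open>g w\<close>, hence the pullback along \<open>g\<close>.\<close>
  moreover have "generic_on S (\<lambda>w. h' (g w) = w)"
    using generic_on_dominated_conj[OF dom hg dominant_pullback[OF g eq]]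
    by (rule generic_on_mono) auto
  ultimately show ?thesis using g unfolding birational_map_def by blast
qed

lemma generic_on_comp_bij:
  assumes P: "generic_on S P" and f: "polynomial_function f" and bij: "f ` S = S"
  shows "generic_on S (\<lambda>v. P (f v))"
proof -
  obtain D where D: "real_polynomial_function D" "\<exists>w\<in>S. D w \<noteq> 0" "\<And>w. w \<in> S \<Longrightarrow> D w \<noteq> 0 \<Longrightarrow> P w"
    using P unfolding generic_on_def by blast
  have "real_polynomial_function (D \<circ> f)" using f D(1) by (rule real_polynomial_function_compose)
  moreover have "\<exists>w\<in>S. (D \<circ> f) w \<noteq> 0" using D(2) bij by (metis comp_apply imageE)
  moreover have "P (f w)" if "w \<in> S" "(D \<circ> f) w \<noteq> 0" for w using that D(3) bij by auto
  ultimately show ?thesis unfolding generic_on_def by blast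
qed

lemma birational_map_polynomial_comp:
  fixes f f' :: "'b::euclidean_space \<Rightarrow> 'b"
  assumes bir: "birational_map UNIV S h"
    and f: "polynomial_function f" "f ` S = S" and f': "polynomial_function f'"
    and inv: "\<And>x. f' (f x) = x" "\<And>x. f (f' x) = x"
  shows "birational_map UNIV S (\<lambda>v. f (h v))"
proof -
  obtain g where dom: "dominant_rational_map UNIV S h" and g: "dominant_rational_map S UNIV g"
    and gh: "generic_on UNIV (\<lambda>v. g (h v) = v)" and hg: "generic_on S (\<lambda>w. h (g w) = w)"
    using bir unfolding birational_map_def by blast
  have "f' ` f ` S = S" by (simp add: image_image inv)
  then have f'S: "f' ` S = S" by (simp add: f(2))
  have dom': "dominant_rational_map UNIV S (\<lambda>v. f (h v))"
    unfolding dominant_rational_map_def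
  proof (intro conjI ballI allI impI)
    fix e :: 'b assume "e \<in> Basis"
    have "real_polynomial_function (\<lambda>x. f x \<bullet> e)"
      using f(1) bounded_linear_inner_left unfolding polynomial_function_def o_def by blast
    then show "rational_function_on UNIV (\<lambda>v. f (h v) \<bullet> e)"
      by (rule rational_function_on_compose_poly) (use dom in \<open>auto simp: dominant_rational_map_def\<close>)
  next
    have "generic_on UNIV (\<lambda>v. h v \<in> S)" using dom unfolding dominant_rational_map_def by blast
    then show "generic_on UNIV (\<lambda>v. f (h v) \<in> S)"
      by (rule generic_on_mono) (use f(2) in auto)
  next
    fix D :: "'b \<Rightarrow> real" assume D: "real_polynomial_function D" "\<exists>w\<in>S. D w \<noteq> 0"
    from D(1) have "real_polynomial_function (D \<circ> f)"
      using f by (auto intro: real_polynomial_function_compose)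
    moreover have "\<exists>w\<in>S. (D \<circ> f) w \<noteq> 0" using D(2) f(2) by (metis comp_apply imageE)
    ultimately show "generic_on UNIV (\<lambda>v. D (f (h v)) \<noteq> 0)"
      using dom unfolding dominant_rational_map_def o_def by blast
  qed
  \<comment> \<open>The rational inverse of \<open>f\<close> after \<open>h\<close> is
    \<open>g\<close> after \<open>f'\<close>.\<close>
  have g': "dominant_rational_map S UNIV (\<lambda>w. g (f' w))"
    unfolding dominant_rational_map_def
  proof (intro conjI ballI allI impI)
    fix e :: 'a assume "e \<in> Basis"
    then obtain N D where ND: "real_polynomial_function N" "real_polynomial_function D"
      "\<exists>v\<in>S. D v \<noteq> 0" "\<And>v. v \<in> S \<Longrightarrow> D v \<noteq> 0 \<Longrightarrow> g v \<bullet> e = N v / D v"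
      using g unfolding dominant_rational_map_def rational_function_on_def by meson
    have "real_polynomial_function (N \<circ> f')" "real_polynomial_function (D \<circ> f')"
      using ND f' by (auto intro: real_polynomial_function_compose)
    moreover have "\<exists>v\<in>S. (D \<circ> f') v \<noteq> 0" using ND(3) f'S by (metis comp_apply imageE)
    moreover have "g (f' v) \<bullet> e = (N \<circ> f') v / (D \<circ> f') v" if "v \<in> S" "(D \<circ> f') v \<noteq> 0" for v
      using that ND(4) f'S by auto
    ultimately show "rational_function_on S (\<lambda>v. g (f' v) \<bullet> e)"
      unfolding rational_function_on_def by blast
  next
    have "generic_on S (\<lambda>v. g v \<in> UNIV)" using g unfolding dominant_rational_map_def by blast
    then show "generic_on S (\<lambda>v. g (f' v) \<in> UNIV)" by simp
  next
    fix D :: "'a \<Rightarrow> real" assume "real_polynomial_function D" "\<exists>w\<in>UNIV. D w \<noteq> 0"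
    then have "generic_on S (\<lambda>v. D (g v) \<noteq> 0)"
      using g unfolding dominant_rational_map_def by blast
    then show "generic_on S (\<lambda>v. D (g (f' v)) \<noteq> 0)"
      by (rule generic_on_comp_bij[OF _ f' f'S])
  qed
  have "generic_on S (\<lambda>w. f (h (g (f' w))) = w)"
    using generic_on_comp_bij[OF hg f' f'S] by (rule generic_on_mono) (simp add: inv)
  then show ?thesis
    unfolding birational_map_def using dom' g' gh by (auto simp: inv)
qed

lemma zariski_closure_image:
  fixes f f' :: "'b::euclidean_space \<Rightarrow> 'b"
  assumes f: "polynomial_function f" and f': "polynomial_function f'"
    and inv: "\<And>x. f' (f x) = x" "\<And>x. f (f' x) = x"
  shows "zariski_closure (f ` A) = f ` zariski_closure A"
proof -
  have sub: "f x \<in> zariski_closure (f ` A)"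
    if "x \<in> zariski_closure A" "polynomial_function f" for x A and f :: "'b \<Rightarrow> 'b"
    unfolding zariski_closure_def
  proof (clarify)
    fix P :: "'b \<Rightarrow> real" assume P: "real_polynomial_function P" "\<forall>a\<in>f ` A. P a = 0"
    then have "real_polynomial_function (P \<circ> f)" "\<forall>a\<in>A. (P \<circ> f) a = 0"
      using that(2) by (auto intro: real_polynomial_function_compose)
    then have "(P \<circ> f) x = 0" using that(1) unfolding zariski_closure_def by blast
    then show "P (f x) = 0" by simp
  qed
  show ?thesis
  proof
    show "f ` zariski_closure A \<subseteq> zariski_closure (f ` A)" using sub f by blast
    show "zariski_closure (f ` A) \<subseteq> f ` zariski_closure A"
    proof
      fix y assume "y \<in> zariski_closure (f ` A)"
      from sub[OF this f'] have "f' y \<in> zariski_closure A" by (simp add: image_image inv)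
      then show "y \<in> f ` zariski_closure A" by (metis image_eqI inv(2))
    qed
  qed
qed

section \<open>Isometries as invertible polynomial maps acting on parametrizations\<close>

lemma polynomial_function_affine:
  fixes Q :: "real ^ 'n ^ 'm"
  shows "polynomial_function (\<lambda>x. Q *v x + b)"
  by (intro polynomial_function_add polynomial_function_const polynomial_function_bounded_linear
      matrix_vector_mul_bounded_linear)

lemma orthogonal_affine_inverse:
  fixes Q :: "real ^ 'n ^ 'n"
  assumes "orthogonal_matrix Q"
  shows "transpose Q *v (Q *v x + b) + - (transpose Q *v b) = x"
    "Q *v (transpose Q *v x + - (transpose Q *v b)) + b = x"
  using assms unfolding orthogonal_matrix_def
  by (simp_all add: matrix_vector_right_distrib matrix_vector_mul_assoc
      linear_neg[OF matrix_vector_mul_linear] matrix_vector_mult_diff_distrib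
      del: transpose_matrix_vector)

lemma isometry_symmetry_inverse:
  assumes "isometry_symmetry S Q b"
  shows "isometry_symmetry S (transpose Q) (- (transpose Q *v b))"
proof -
  have Q: "orthogonal_matrix Q" and S: "(\<lambda>x. Q *v x + b) ` S = S"
    using assms by (auto simp: isometry_symmetry_def)
  have "(\<lambda>x. transpose Q *v x + - (transpose Q *v b)) ` (\<lambda>x. Q *v x + b) ` S = S"
    by (simp only: image_image orthogonal_affine_inverse[OF Q] image_ident)
  then show ?thesis using Q S by (simp add: isometry_symmetry_def)
qed

text \<open>The closure of the moved image is \<open>f(S)\<close>, which is \<open>S\<close> by
  symmetry. So both parametrizations belong to the same surface and can be compared through
  \<open>doubly_ruled\<close>.\<close>

lemma properly_parametrizes_affine:
  assumes proper: "properly_parametrizes p q S" and sym: "isometry_symmetry S Q b"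
  shows "properly_parametrizes (affine_fract Q b p) (linear_poly Q q) S"
proof -
  let ?p = "affine_fract Q b p" and ?q = "linear_poly Q q"
  let ?f = "\<lambda>x. Q *v x + b" and ?f' = "\<lambda>x. transpose Q *v x + - (transpose Q *v b)"
  have Q: "orthogonal_matrix Q" and S: "?f ` S = S"
    using sym by (auto simp: isometry_symmetry_def)
  have SS: "S = ruled_surface p q" and bir: "birational_map UNIV S (ruled_map p q)"
    using proper by (auto simp: properly_parametrizes_def)
  note poly = polynomial_function_affine[of Q b]
    polynomial_function_affine[of "transpose Q" "- (transpose Q *v b)"]
  note inv = orthogonal_affine_inverse[OF Q, of _ b]
  have img: "ruled_map ?p ?q ` (ruled_dom ?p \<times> UNIV) = ?f ` ruled_map p q ` (ruled_dom p \<times> UNIV)"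
    unfolding ruled_dom_affine[OF Q] image_image by (intro image_cong refl) (auto simp: ruled_map_affine)
  have "ruled_surface ?p ?q = ?f ` ruled_surface p q"
    unfolding ruled_surface_def img by (rule zariski_closure_image[OF poly inv])
  with S SS have "S = ruled_surface ?p ?q" by simp
  moreover have "birational_map UNIV S (\<lambda>z. ?f (ruled_map p q z))"
    by (rule birational_map_polynomial_comp[OF bir poly(1) S poly(2) inv])
  then have "birational_map UNIV S (ruled_map ?p ?q)"
    by (rule birational_map_cong)
      (rule generic_on_mono[OF generic_on_fst[OF ruled_dom_cofinite[of p]]], auto simp: ruled_map_affine)
  ultimately show ?thesis by (simp add: properly_parametrizes_def)
qed

lemma rulings_affine:
  assumes "orthogonal_matrix Q"
  shows "rulings (affine_fract Q b p) (linear_poly Q q) =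
    {(\<lambda>x. Q *v x + b) ` range (\<lambda>s. ruled_map p q (t, s)) |t. t \<in> ruled_dom p}"
  unfolding rulings_def ruled_dom_affine[OF assms]
  by (auto simp: ruled_map_affine image_image) (metis (no_types, lifting) image_cong ruled_map_affine)+

subsection \<open>The action of a symmetry on the rulings\<close>

abbreviation direction :: "real poly ^ 3 \<Rightarrow> real \<Rightarrow> real ^ 3" where
  "direction q t \<equiv> \<chi> i. poly (q $ i) t"

lemma inj_ruled_map:
  "direction q t \<noteq> 0 \<Longrightarrow> inj (\<lambda>s. ruled_map p q (t, s))"
  by (rule injI) (simp add: ruled_map_def)

text \<open>The inverse \<open>g\<close> reads the parameter off almost every point of a ruling. If
  two rulings coincide, some common point yields both parameters. This converts finitely many lines
  into finitely many parameters.\<close>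

lemma inj_on_rulings:
  assumes nz: "\<And>t. direction q t \<noteq> 0"
  shows "inj_on (\<lambda>t. range (\<lambda>s. ruled_map p q (t, s)))
           {t. \<forall>\<^sub>F s in cofinite. g (ruled_map p q (t, s)) = (t, s)}"
proof (rule inj_onI, clarify)
  fix t t' assume t: "\<forall>\<^sub>F s in cofinite. g (ruled_map p q (t, s)) = (t, s)"
    and t': "\<forall>\<^sub>F s in cofinite. g (ruled_map p q (t', s)) = (t', s)"
    and eq: "range (\<lambda>s. ruled_map p q (t, s)) = range (\<lambda>s. ruled_map p q (t', s))"
  have "\<exists>s'. ruled_map p q (t, s) = ruled_map p q (t', s')" for s
    using eq by (metis (no_types, lifting) imageE rangeI)
  then obtain \<sigma> where \<sigma>: "\<And>s. ruled_map p q (t, s) = ruled_map p q (t', \<sigma> s)" by metis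
  \<comment> \<open>Without injectivity of \<open>\<sigma>\<close>, the points
    \<open>\<sigma> s\<close> might all be exceptional for \<open>t'\<close>.\<close>
  have "filterlim \<sigma> cofinite cofinite"
  proof (intro filterlim_cofinite_inj injI)
    fix s s' assume "\<sigma> s = \<sigma> s'"
    then have "ruled_map p q (t, s) = ruled_map p q (t, s')" by (simp only: \<sigma>[of s] \<sigma>[of s'])
    then show "s = s'" by (rule injD[OF inj_ruled_map[OF nz]])
  qed
  from eventually_compose_filterlim[OF t' this] t
  have "\<forall>\<^sub>F s::real in cofinite. t = t'" by eventually_elim (metis \<sigma> prod.inject)
  then show "t = t'" by (rule eventually_cofinite_realE)
qed

text \<open>Subtracting the image of the point with \<open>s = 0\<close> removes the base points and
  \<open>b\<close>. What remains is a relation between the directions alone, which makes the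
  reparametrization affine in \<open>s\<close>.\<close>

lemma line_onto_line_affine:
  assumes nz: "direction q t \<noteq> 0" and Q: "orthogonal_matrix Q"
    and img: "(\<lambda>x. Q *v x + b) ` range (\<lambda>s. ruled_map p q (t, s)) = range (\<lambda>s. ruled_map p q (t', s))"
  obtains a c where "a \<noteq> 0" "Q *v direction q t = a *\<^sub>R direction q t'"
    "\<And>s. Q *v ruled_map p q (t, s) + b = ruled_map p q (t', a * s + c)"
proof -
  have "\<exists>s'. Q *v ruled_map p q (t, s) + b = ruled_map p q (t', s')" for s
  proof -
    have "Q *v ruled_map p q (t, s) + b \<in> range (\<lambda>s. ruled_map p q (t', s))"
      unfolding img[symmetric] by blast
    then show ?thesis by blast
  qed
  then obtain \<sigma> where \<sigma>: "\<And>s. Q *v ruled_map p q (t, s) + b = ruled_map p q (t', \<sigma> s)" by metis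
  have diff: "s *\<^sub>R (Q *v direction q t) = (\<sigma> s - \<sigma> 0) *\<^sub>R direction q t'" for s
  proof -
    have "s *\<^sub>R (Q *v direction q t) =
        (Q *v ruled_map p q (t, s) + b) - (Q *v ruled_map p q (t, 0) + b)"
      by (simp add: ruled_map_def matrix_vector_right_distrib matrix_vector_mult_scaleR)
    also have "\<dots> = (\<sigma> s - \<sigma> 0) *\<^sub>R direction q t'"
      unfolding \<sigma> by (simp add: ruled_map_def scaleR_left_diff_distrib)
    finally show ?thesis .
  qed
  define a where "a = \<sigma> 1 - \<sigma> 0"
  have dir: "Q *v direction q t = a *\<^sub>R direction q t'" using diff[of 1] by (simp add: a_def)
  have Qnz: "Q *v direction q t \<noteq> 0"
    using orthogonal_affine_inverse(1)[OF Q, of "direction q t" 0] nz by auto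
  have affine: "\<sigma> s = a * s + \<sigma> 0" for s
  proof -
    have "(s * a) *\<^sub>R direction q t' = (\<sigma> s - \<sigma> 0) *\<^sub>R direction q t'" using diff[of s] dir by simp
    moreover have "direction q t' \<noteq> 0" using Qnz dir by auto
    ultimately have "s * a = \<sigma> s - \<sigma> 0" by (simp only: scaleR_cancel_right) simp
    then show ?thesis by (simp add: algebra_simps)
  qed
  show thesis
  proof (rule that[OF _ dir])
    show "a \<noteq> 0" using dir Qnz by auto
    show "Q *v ruled_map p q (t, s) + b = ruled_map p q (t', a * s + \<sigma> 0)" for s
      by (simp only: \<sigma>[of s] affine[of s])
  qed
qed

text \<open>On almost every ruling, \<open>f\<close> acts as an affine map onto another ruling. The
  inverse \<open>g\<close> of the parametrization then reads off \<open>\<phi>\<close> there, since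
  \<open>\<phi>\<close> is generically \<open>g\<close> after \<open>f\<close> after
  \<open>ruled_map p q\<close>.\<close>

proposition symmetry_fibre_preserving:
  fixes \<phi> :: "real \<times> real \<Rightarrow> real \<times> real"
  assumes proper: "properly_parametrizes p q S" and ndr: "\<not> doubly_ruled S"
    and nz: "\<And>t. direction q t \<noteq> 0"
    and sym: "isometry_symmetry S Q b"
    and dom: "dominant_rational_map UNIV UNIV \<phi>"
    and commutes: "generic_on UNIV (\<lambda>z. Q *v ruled_map p q z + b = ruled_map p q (\<phi> z))"
  obtains \<psi> a c where "filterlim \<psi> cofinite cofinite"
    "\<forall>\<^sub>F t in cofinite. a t \<noteq> 0 \<and> Q *v direction q t = a t *\<^sub>R direction q (\<psi> t) \<and>
       (\<forall>\<^sub>F s in cofinite. \<phi> (t, s) = (\<psi> t, a t * s + c t))"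
proof -
  let ?f = "\<lambda>x. Q *v x + b" and ?x = "ruled_map p q"
  let ?L = "\<lambda>t. range (\<lambda>s. ?x (t, s))"
  have Q: "orthogonal_matrix Q" using sym by (simp add: isometry_symmetry_def)
  have inj_f: "inj ?f" by (rule inj_on_inverseI, rule orthogonal_affine_inverse(1)[OF Q])
  obtain g where gx: "generic_on UNIV (\<lambda>z. g (?x z) = z)"
    using proper unfolding properly_parametrizes_def birational_map_def by blast
  define G where "G = {t. \<forall>\<^sub>F s in cofinite. g (?x (t, s)) = (t, s)}"
  have G: "\<forall>\<^sub>F t in cofinite. t \<in> G"
    using generic_on_UNIV_imp_cofinite[OF gx] by (simp add: G_def)
  have inj_L: "inj_on ?L G" unfolding G_def using nz by (rule inj_on_rulings)
  have inj_fL: "inj_on (\<lambda>t. ?f ` ?L t) G"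
  proof (rule inj_onI)
    fix t t' assume "t \<in> G" "t' \<in> G" "?f ` ?L t = ?f ` ?L t'"
    then show "t = t'" using inj_L inj_f by (metis (no_types, lifting) inj_image_eq_iff inj_onD)
  qed
  \<comment> \<open>Dominance of \<open>\<phi>\<close> allows the generic identity
    \<open>g (?x z) = z\<close> to be evaluated at \<open>\<phi> z\<close>.\<close>
  have "generic_on UNIV (\<lambda>z. g (?x (\<phi> z)) = \<phi> z)"
    using dominant_pullback[OF dom gx] by simp
  from generic_on_UNIV_conj[OF this commutes]
  have "generic_on UNIV (\<lambda>z. g (?f (?x z)) = \<phi> z)" by (rule generic_on_mono) auto
  from generic_on_UNIV_imp_cofinite[OF this]
  have gf: "\<forall>\<^sub>F t in cofinite. \<forall>\<^sub>F s in cofinite. g (?f (?x (t, s))) = \<phi> (t, s)" .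

  \<comment> \<open>\<open>T\<close> collects the parameters whose ruling is moved off the family.
    Their images are lines of the moved family outside the original one, finite in number because
    \<open>S\<close> is not doubly ruled.\<close>
  define T where "T = {t \<in> ruled_dom p \<inter> G. \<not> (\<exists>t'\<in>ruled_dom p. ?f ` ?L t = ?L t')}"
  have "finite (rulings (affine_fract Q b p) (linear_poly Q q) - rulings p q)"
    using ndr proper properly_parametrizes_affine[OF proper sym] unfolding doubly_ruled_def
    by (metis finite_Un)
  moreover have "(\<lambda>t. ?f ` ?L t) ` T \<subseteq>
      rulings (affine_fract Q b p) (linear_poly Q q) - rulings p q"
    unfolding rulings_affine[OF Q] unfolding rulings_def T_def by blast
  ultimately have "finite ((\<lambda>t. ?f ` ?L t) ` T)" by (rule rev_finite_subset)
  moreover have "inj_on (\<lambda>t. ?f ` ?L t) T"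
    using inj_fL by (rule inj_on_subset) (auto simp: T_def)
  ultimately have "finite T" by (rule finite_imageD)
  then have "\<forall>\<^sub>F t in cofinite. t \<notin> T" by (simp add: eventually_cofinite)
  with ruled_dom_cofinite[of p] G have "\<forall>\<^sub>F t in cofinite. t \<in> G \<and> (\<exists>t'. ?f ` ?L t = ?L t')"
    by eventually_elim (auto simp: T_def)
  then have K: "\<forall>\<^sub>F t in cofinite. t \<in> {t \<in> G. \<exists>t'. ?f ` ?L t = ?L t'}" (is "\<forall>\<^sub>F t in _. t \<in> ?K")
    by simp
  \<comment> \<open>No regularity of \<open>\<psi>\<close> is known here; injectivity on
    \<open>?K\<close> is enough to compose with it.\<close>
  define \<psi> where "\<psi> t = (SOME t'. ?f ` ?L t = ?L t')" for t
  have \<psi>: "?f ` ?L t = ?L (\<psi> t)" if "t \<in> ?K" for t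
  proof -
    have "\<exists>t'. ?f ` ?L t = ?L t'" using that by blast
    then show ?thesis unfolding \<psi>_def by (rule someI_ex)
  qed
  have "inj_on \<psi> ?K"
  proof (rule inj_onI)
    fix t t' assume *: "t \<in> ?K" "t' \<in> ?K" "\<psi> t = \<psi> t'"
    then have "?f ` ?L t = ?f ` ?L t'" using \<psi>[of t] \<psi>[of t'] by (simp only:)
    with * inj_fL show "t = t'" unfolding inj_on_def by blast
  qed
  then have lim: "filterlim \<psi> cofinite cofinite" using K by (rule filterlim_cofinite_inj_on)
  have "\<forall>\<^sub>F t in cofinite. \<exists>a c. a \<noteq> 0 \<and> Q *v direction q t = a *\<^sub>R direction q (\<psi> t) \<and>
       (\<forall>\<^sub>F s in cofinite. \<phi> (t, s) = (\<psi> t, a * s + c))"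
    using K gf eventually_compose_filterlim[OF G lim]
  proof eventually_elim
    case (elim t)
    obtain a c where ac: "a \<noteq> 0" "Q *v direction q t = a *\<^sub>R direction q (\<psi> t)"
      "\<And>s. ?f (?x (t, s)) = ?x (\<psi> t, a * s + c)"
      using line_onto_line_affine[OF nz Q \<psi>[OF elim(1)]] by blast
    have "inj (\<lambda>s. a * s + c)" using ac(1) by (simp add: inj_def)
    then have "filterlim (\<lambda>s. a * s + c) cofinite cofinite" by (rule filterlim_cofinite_inj)
    moreover have "\<forall>\<^sub>F s in cofinite. g (?x (\<psi> t, s)) = (\<psi> t, s)"
      using elim(3) by (simp add: G_def)
    ultimately have "\<forall>\<^sub>F s in cofinite. g (?x (\<psi> t, a * s + c)) = (\<psi> t, a * s + c)"
      by (rule eventually_compose_filterlim[rotated])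
    with elim(2) have "\<forall>\<^sub>F s in cofinite. \<phi> (t, s) = (\<psi> t, a * s + c)"
      by eventually_elim (metis ac(3))
    with ac show ?case by blast
  qed
  \<comment> \<open>Choice, in the form of \<open>eventually_ex\<close>, turns the numbers found for
    each \<open>t\<close> into functions of \<open>t\<close>.\<close>
  then have "\<exists>a c. \<forall>\<^sub>F t in cofinite. a t \<noteq> 0 \<and> Q *v direction q t = a t *\<^sub>R direction q (\<psi> t) \<and>
       (\<forall>\<^sub>F s in cofinite. \<phi> (t, s) = (\<psi> t, a t * s + c t))"
    by (simp only: eventually_ex)
  then show thesis using that lim by blast
qed

text \<open>On a suitable horizontal line \<open>s = s0\<close> the function \<open>h\<close> is
  rational in \<open>t\<close>, and subtracting \<open>s0 * a t\<close> leaves \<open>c\<close>.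
  With \<open>a = 0\<close> the lemma also covers components independent of
  \<open>s\<close>.\<close>

lemma cofinitely_rational_section:
  fixes h :: "real \<times> real \<Rightarrow> real"
  assumes h: "rational_function_on UNIV h"
    and eq: "\<forall>\<^sub>F t in cofinite. \<forall>\<^sub>F s in cofinite. h (t, s) = a t * s + c t"
    and a: "cofinitely_rational a"
  shows "cofinitely_rational c"
proof -
  obtain N D where ND: "real_polynomial_function N" "real_polynomial_function D"
    "\<forall>\<^sub>F s in cofinite. \<forall>\<^sub>F t in cofinite. D (t, s) \<noteq> 0"
    "\<And>v. D v \<noteq> 0 \<Longrightarrow> h v = N v / D v"
    using rational_function_on_cofinite_regular[OF h] by blast
  from eventually_cofinite_realE[OF ND(3)] obtain s0
    where s0: "\<forall>\<^sub>F t in cofinite. D (t, s0) \<noteq> 0" by blast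
  obtain n where n: "\<And>t. N (t, s0) = poly n t"
    using real_polynomial_function_imp_poly[OF real_polynomial_function_sections(2)[OF ND(1)]]
    by metis
  obtain d where d: "\<And>t. D (t, s0) = poly d t"
    using real_polynomial_function_imp_poly[OF real_polynomial_function_sections(2)[OF ND(2)]]
    by metis
  have "d \<noteq> 0" using s0 d by (auto simp: infinite_UNIV_char_0)
  text \<open>The exceptional \<open>s\<close> may vary with \<open>t\<close>, so the identity is first extended to all \<open>s\<close>.\<close>
  from eq s0 have "\<forall>\<^sub>F t in cofinite. poly n t / poly d t + - s0 * a t = c t"
  proof eventually_elim
    case (elim t)
    define F where "F s = N (t, s) - (a t * s + c t) * D (t, s)" for s
    have F: "real_polynomial_function F"
      unfolding F_def
      by (intro real_polynomial_function_diff real_polynomial_function.intros(3,4)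
          real_polynomial_function.intros(2) real_polynomial_function_sections(1) ND
          real_polynomial_function.intros(1) bounded_linear_ident)
    have Dt: "\<forall>\<^sub>F s in cofinite. D (t, s) \<noteq> 0"
      by (rule real_polynomial_function_eventually_nonzero[of _ s0])
        (use elim(2) ND(2) real_polynomial_function_sections(1) in auto)
    have "F s0 = 0"
    proof (rule ccontr)
      assume "F s0 \<noteq> 0"
      from real_polynomial_function_eventually_nonzero[OF F this] elim(1) Dt
      have "\<forall>\<^sub>F s::real in cofinite. False"
        by eventually_elim (auto simp: F_def ND(4) nonzero_divide_eq_eq)
      then show False by (simp add: infinite_UNIV_char_0)
    qed
    then show ?case using elim(2) by (simp add: F_def n d field_simps)
  qed
  moreover have "cofinitely_rational (\<lambda>t. poly n t / poly d t + - s0 * a t)"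
    using \<open>d \<noteq> 0\<close>
    by (intro cofinitely_rational_add cofinitely_rational_mult cofinitely_rational_const a)
      (rule cofinitely_rationalI[of d _ n], auto)
  ultimately show ?thesis by (rule cofinitely_rational_cong[rotated])
qed

subsection \<open>The scaling factor along the rulings\<close>

text \<open>\<open>r\<close> is homogenized as a form of degree \<open>n\<close>, not of its own
  degree, so that all coordinates of a vector of polynomials share the factor
  \<open>(\<gamma> * t + \<delta>) ^ n\<close>.\<close>

lemma moebius_substitution:
  fixes r :: "real poly"
  assumes "degree r \<le> n"
  obtains h where "degree h \<le> n"
    "\<And>t. \<gamma> * t + \<delta> \<noteq> 0 \<Longrightarrow> poly h t = (\<gamma> * t + \<delta>) ^ n * poly r ((\<alpha> * t + \<beta>) / (\<gamma> * t + \<delta>))"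
proof
  let ?h = "\<Sum>i\<le>n. smult (coeff r i) ([:\<beta>, \<alpha>:] ^ i * [:\<delta>, \<gamma>:] ^ (n - i))"
  show "degree ?h \<le> n"
  proof (rule degree_sum_le)
    fix i assume "i \<in> {..n}"
    have "degree ([:\<beta>, \<alpha>:] ^ i) \<le> i" "degree ([:\<delta>, \<gamma>:] ^ (n - i)) \<le> n - i"
      using degree_power_le[of "[:\<beta>, \<alpha>:]" i] degree_power_le[of "[:\<delta>, \<gamma>:]" "n - i"]
      by (auto split: if_splits)
    then show "degree (smult (coeff r i) ([:\<beta>, \<alpha>:] ^ i * [:\<delta>, \<gamma>:] ^ (n - i))) \<le> n"
      using degree_smult_le[of "coeff r i" "[:\<beta>, \<alpha>:] ^ i * [:\<delta>, \<gamma>:] ^ (n - i)"]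
        degree_mult_le[of "[:\<beta>, \<alpha>:] ^ i" "[:\<delta>, \<gamma>:] ^ (n - i)"] \<open>i \<in> {..n}\<close>
      by auto
  qed simp
  fix t assume nz: "\<gamma> * t + \<delta> \<noteq> 0"
  define d where "d = \<gamma> * t + \<delta>"
  have "poly ?h t = (\<Sum>i\<le>n. coeff r i * ((\<alpha> * t + \<beta>) ^ i * d ^ (n - i)))"
    by (simp add: poly_sum d_def algebra_simps)
  also have "\<dots> = (\<Sum>i\<le>n. d ^ n * (coeff r i * ((\<alpha> * t + \<beta>) / d) ^ i))"
  proof (rule sum.cong)
    fix i assume "i \<in> {..n}"
    then have "d ^ n = d ^ i * d ^ (n - i)" by (simp flip: power_add)
    then show "coeff r i * ((\<alpha> * t + \<beta>) ^ i * d ^ (n - i)) = d ^ n * (coeff r i * ((\<alpha> * t + \<beta>) / d) ^ i)"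
      using nz by (simp add: power_divide d_def)
  qed simp
  also have "\<dots> = d ^ n * poly r ((\<alpha> * t + \<beta>) / d)"
  proof -
    have "poly r x = (\<Sum>i\<le>n. coeff r i * x ^ i)" for x
      unfolding poly_altdef using assms by (intro sum.mono_neutral_left) (auto simp: coeff_eq_0)
    then show ?thesis by (simp add: sum_distrib_left)
  qed
  finally show "poly ?h t = (\<gamma> * t + \<delta>) ^ n * poly r ((\<alpha> * t + \<beta>) / (\<gamma> * t + \<delta>))"
    by (simp add: d_def)
qed

text \<open>A Bezout certificate replaces the gcd because it can be evaluated at points, transformed
  by \<open>Q\<close> and multiplied into identities.\<close>

lemma primitive_bezout:
  fixes q :: "real poly ^ 3"
  assumes "gcd (q $ 1) (gcd (q $ 2) (q $ 3)) = 1"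
  obtains e where "(\<Sum>i\<in>UNIV. e i * q $ i) = 1"
proof -
  obtain a b where "a * q $ 2 + b * q $ 3 = gcd (q $ 2) (q $ 3)"
    by (metis bezout_coefficients_fst_snd)
  moreover obtain c d where "c * q $ 1 + d * gcd (q $ 2) (q $ 3) = 1"
    using assms by (metis bezout_coefficients_fst_snd)
  ultimately have "c * q $ 1 + d * a * q $ 2 + d * b * q $ 3 = 1"
    by (metis (no_types, lifting) add.assoc distrib_left mult.assoc)
  then show ?thesis
    by (intro that[of "\<lambda>i. if i = 1 then c else if i = 2 then d * a else d * b"])
      (simp add: sum_3)
qed

lemma primitive_direction_nonzero:
  fixes q :: "real poly ^ 3"
  assumes "(\<Sum>i\<in>UNIV. e i * q $ i) = 1"
  shows "direction q t \<noteq> 0"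
proof
  assume "direction q t = 0"
  then have "poly (\<Sum>i\<in>UNIV. e i * q $ i) t = 0" by (simp add: poly_sum vec_eq_iff)
  with assms show False by simp
qed

lemma scaling_factor:
  fixes q :: "real poly ^ 3"
  assumes bezout: "(\<Sum>i\<in>UNIV. e i * q $ i) = 1"
    and deg: "\<And>i. degree (q $ i) \<le> n" and top: "coeff (q $ k) n \<noteq> 0"
    and Q: "orthogonal_matrix Q"
    and det: "\<alpha> * \<delta> - \<beta> * \<gamma> \<noteq> (0::real)"
    and \<psi>: "\<forall>\<^sub>F t in cofinite. \<psi> t = (\<alpha> * t + \<beta>) / (\<gamma> * t + \<delta>)"
    and a: "\<forall>\<^sub>F t in cofinite. a t \<noteq> 0 \<and> Q *v direction q t = a t *\<^sub>R direction q (\<psi> t)"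
  obtains m where "\<forall>\<^sub>F t in cofinite. a t = m * (\<gamma> * t + \<delta>) ^ n"
proof -
  define w where "w = linear_poly Q q"
  have dw: "direction w t = Q *v direction q t" for t by (simp add: w_def poly_linear_poly)
  have QQ: "(\<Sum>i\<in>UNIV. Q $ i $ l * Q $ i $ j) = (if l = j then 1 else 0)" for j l
    using Q unfolding orthogonal_matrix_def
    by (auto simp: matrix_matrix_mult_def transpose_def mat_def vec_eq_iff)
  \<comment> \<open>\<open>q\<close> is the transpose of \<open>Q\<close> applied to
    \<open>w\<close>. This transfers both primitivity and the nonzero coefficient in degree
    \<open>n\<close> from \<open>q\<close> to \<open>w\<close>.\<close>
  have q_w: "q $ l = (\<Sum>i\<in>UNIV. smult (Q $ i $ l) (w $ i))" for l
  proof -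
    have "(\<Sum>i\<in>UNIV. smult (Q $ i $ l) (w $ i)) =
        (\<Sum>i\<in>UNIV. \<Sum>j\<in>UNIV. smult (Q $ i $ l * Q $ i $ j) (q $ j))"
      by (simp add: w_def linear_poly_def sum_3 smult_add_right)
    also have "\<dots> = (\<Sum>j\<in>UNIV. smult (\<Sum>i\<in>UNIV. Q $ i $ l * Q $ i $ j) (q $ j))"
      by (subst sum.swap) (simp add: smult_sum)
    also have "\<dots> = q $ l" by (simp add: QQ if_distrib[of "\<lambda>x. smult x _"] cong: if_cong)
    finally show ?thesis ..
  qed
  \<comment> \<open>\<open>e'\<close> is \<open>Q\<close> applied to \<open>e\<close>; an orthogonal
    matrix preserves the pairing of \<open>e\<close> with \<open>q\<close>.\<close>
  define e' where "e' i = (\<Sum>l\<in>UNIV. smult (Q $ i $ l) (e l))" for i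
  have bezout_w: "(\<Sum>i\<in>UNIV. e' i * w $ i) = 1"
  proof -
    have "(\<Sum>i\<in>UNIV. e' i * w $ i) = (\<Sum>i\<in>UNIV. \<Sum>l\<in>UNIV. e l * smult (Q $ i $ l) (w $ i))"
      by (simp add: e'_def sum_distrib_right)
    also have "\<dots> = (\<Sum>l\<in>UNIV. e l * q $ l)"
      by (subst sum.swap) (simp add: q_w sum_distrib_left)
    finally show ?thesis using bezout by simp
  qed
  obtain j where j: "coeff (w $ j) n \<noteq> 0"
  proof (rule ccontr)
    assume "\<not> thesis"
    then have "coeff (w $ j) n = 0" for j using that by blast
    then have "coeff (q $ k) n = 0" by (subst q_w) (simp add: coeff_sum)
    with top show False by simp
  qed
  have "\<exists>h. degree h \<le> n \<and> (\<forall>t. \<gamma> * t + \<delta> \<noteq> 0 \<longrightarrow>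
      poly h t = (\<gamma> * t + \<delta>) ^ n * poly (q $ i) ((\<alpha> * t + \<beta>) / (\<gamma> * t + \<delta>)))" for i
    using moebius_substitution[OF deg] by metis
  then obtain h where h: "\<And>i. degree (h i) \<le> n" "\<And>i t. \<gamma> * t + \<delta> \<noteq> 0 \<Longrightarrow>
      poly (h i) t = (\<gamma> * t + \<delta>) ^ n * poly (q $ i) ((\<alpha> * t + \<beta>) / (\<gamma> * t + \<delta>))" by metis
  have "[:\<delta>, \<gamma>:] \<noteq> 0" using det by auto
  from poly_eventually_nonzero[OF this] have d: "\<forall>\<^sub>F t in cofinite. \<gamma> * t + \<delta> \<noteq> 0"
    by eventually_elim (simp add: algebra_simps)
  have ev: "\<forall>\<^sub>F t in cofinite. \<gamma> * t + \<delta> \<noteq> 0 \<and> a t \<noteq> 0 \<and>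
      (\<forall>i. (\<gamma> * t + \<delta>) ^ n * poly (w $ i) t = a t * poly (h i) t)"
    using d \<psi> a
  proof eventually_elim
    case (elim t)
    have "poly (w $ i) t = a t * poly (q $ i) (\<psi> t)" for i
      using elim(3) dw[of t] by (simp add: vec_eq_iff)
    then show ?case using elim by (simp add: h(2))
  qed
  \<comment> \<open>Eliminating \<open>a\<close>, of which no rationality is known, leaves parallel
    vectors of polynomials.\<close>
  have cross: "w $ i * h l = w $ l * h i" for i l
  proof (rule poly_eqI_cofinite)
    show "\<forall>\<^sub>F t in cofinite. poly (w $ i * h l) t = poly (w $ l * h i) t"
      using ev
    proof eventually_elim
      case (elim t)
      let ?d = "(\<gamma> * t + \<delta>) ^ n"
      have "?d * poly (w $ i) t = a t * poly (h i) t" "?d * poly (w $ l) t = a t * poly (h l) t"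
        using elim by blast+
      then have "a t * poly (h i) t * (?d * poly (w $ l) t) = (?d * poly (w $ i) t) * (a t * poly (h l) t)"
        by simp
      then have "(a t * ?d) * (poly (w $ i) t * poly (h l) t) = (a t * ?d) * (poly (w $ l) t * poly (h i) t)"
        by (simp only: mult_ac)
      then show ?case using elim by simp
    qed
  qed
  \<comment> \<open>Pairing with the certificate solves \<open>h = K * w\<close> for the factor:
    \<open>w\<close> pairs to 1, so \<open>K\<close> is what \<open>h\<close> pairs to, and it is a
    polynomial.\<close>
  define K where "K = (\<Sum>i\<in>UNIV. e' i * h i)"
  have hK: "h l = K * w $ l" for l
  proof -
    have "h l = (\<Sum>i\<in>UNIV. e' i * w $ i) * h l" by (simp add: bezout_w)
    also have "\<dots> = (\<Sum>i\<in>UNIV. e' i * (w $ i * h l))" by (simp add: sum_distrib_right mult.assoc)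
    also have "\<dots> = (\<Sum>i\<in>UNIV. e' i * (w $ l * h i))" by (simp only: cross[of _ l])
    also have "\<dots> = K * w $ l" 
      by (simp add: K_def sum_distrib_right mult.assoc mult.commute[of "w $ l"])
    finally show ?thesis .
  qed
  obtain t0 where t0: "\<gamma> * t0 + \<delta> \<noteq> 0" "a t0 \<noteq> 0"
    "\<And>i. (\<gamma> * t0 + \<delta>) ^ n * poly (w $ i) t0 = a t0 * poly (h i) t0"
    using eventually_cofinite_realE[OF ev] by blast
  have "K \<noteq> 0"
  proof
    assume "K = 0"
    then have "direction w t0 = 0" using t0 by (simp add: hK vec_eq_iff)
    then show False using primitive_direction_nonzero[OF bezout_w, of t0] by simp
  qed
  \<comment> \<open>The coordinate \<open>w $ j\<close> already has degree at least
    \<open>n\<close>, while \<open>h j\<close> has degree at most \<open>n\<close>, leaving no room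
    for a non-constant \<open>K\<close>.\<close>
  have "degree K = 0"
  proof -
    have "w $ j \<noteq> 0" "n \<le> degree (w $ j)" using j by (auto intro: le_degree)
    moreover have "degree K + degree (w $ j) \<le> n"
      using h(1)[of j] \<open>K \<noteq> 0\<close> \<open>w $ j \<noteq> 0\<close> by (simp add: hK degree_mult_eq)
    ultimately show ?thesis by simp
  qed
  then obtain \<kappa> where \<kappa>: "K = [:\<kappa>:]" by (rule degree_eq_zeroE)
  with \<open>K \<noteq> 0\<close> have "\<kappa> \<noteq> 0" by simp
  have "\<forall>\<^sub>F t in cofinite. a t = 1 / \<kappa> * (\<gamma> * t + \<delta>) ^ n"
    using ev
  proof eventually_elim
    case (elim t)
    obtain i where i: "poly (w $ i) t \<noteq> 0"
      using primitive_direction_nonzero[OF bezout_w, of t] by (auto simp: vec_eq_iff)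
    have "(\<gamma> * t + \<delta>) ^ n * poly (w $ i) t = a t * poly (h i) t"
      using elim by blast
    then have "(\<gamma> * t + \<delta>) ^ n = a t * \<kappa>" using i by (simp add: hK \<kappa>)
    then show ?case using \<open>\<kappa> \<noteq> 0\<close> by simp
  qed
  then show ?thesis by (rule that)
qed


lemma Max_degree_coeff:
  fixes q :: "real poly ^ 3"
  assumes n: "n = Max {degree (q $ 1), degree (q $ 2), degree (q $ 3)}" and "q \<noteq> 0"
  shows "degree (q $ i) \<le> n" "\<exists>k. coeff (q $ k) n \<noteq> 0"
proof -
  have set: "{degree (q $ 1), degree (q $ 2), degree (q $ 3)} = range (\<lambda>i. degree (q $ i))"
    unfolding UNIV_3 by auto
  show le: "degree (q $ i) \<le> n" for i unfolding n set by (rule Max_ge) auto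
  have "n \<in> range (\<lambda>i. degree (q $ i))" unfolding n set by (rule Max_in) auto
  then obtain m where m: "n = degree (q $ m)" by blast
  show "\<exists>k. coeff (q $ k) n \<noteq> 0"
  proof (cases "q $ m = 0")
    case False
    then show ?thesis unfolding m by (metis leading_coeff_0_iff)
  next
    \<comment> \<open>The zero polynomial has degree 0, so it can attain the maximum when
      \<open>n = 0\<close>; then all degrees are 0 and any nonzero component serves.\<close>
    case True
    obtain k where "q $ k \<noteq> 0" using \<open>q \<noteq> 0\<close> by (auto simp: vec_eq_iff)
    moreover have "degree (q $ k) = n" using le[of k] m True by simp
    ultimately show ?thesis by (metis leading_coeff_0_iff)
  qed
qed

theorem theorem7:
  fixes p :: "real poly fract ^ 3" and q :: "real poly ^ 3" and S :: "(real ^ 3) set"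
    and Q :: "real ^ 3 ^ 3" and b :: "real ^ 3"
    and \<phi> :: "real \<times> real \<Rightarrow> real \<times> real" and n :: nat
  assumes proper: "properly_parametrizes p q S"
    and primitive: "gcd (q $ 1) (gcd (q $ 2) (q $ 3)) = 1"
    and not_doubly_ruled: "\<not> doubly_ruled S"
    and not_cylindrical: "\<not> cylindrical q"
    and not_revolution: "\<not> surface_of_revolution S"
    and n: "n = Max {degree (q $ 1), degree (q $ 2), degree (q $ 3)}"
    and symmetry: "isometry_symmetry S Q b"
    and birational: "birational_map UNIV UNIV \<phi>"
    and commutes: "generic_on UNIV (\<lambda>z. Q *v ruled_map p q z + b = ruled_map p q (\<phi> z))"
  shows "\<exists>(\<alpha>::real) (\<beta>::real) (\<gamma>::real) (\<delta>::real) (k::real) (c :: real poly fract).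
           \<alpha> * \<delta> - \<beta> * \<gamma> \<noteq> 0 \<and>
           generic_on UNIV (\<lambda>(t, s).
             \<phi> (t, s) = ((\<alpha> * t + \<beta>) / (\<gamma> * t + \<delta>),
                         k * (\<gamma> * t + \<delta>) ^ n * s + rat_eval c t))"
proof -
  obtain e where bezout: "(\<Sum>i\<in>UNIV. e i * q $ i) = 1" using primitive_bezout[OF primitive] by blast
  have nz: "direction q t \<noteq> 0" for t using bezout by (rule primitive_direction_nonzero)
  have "q \<noteq> 0" using bezout by auto
  have Q: "orthogonal_matrix Q" using symmetry by (simp add: isometry_symmetry_def)
  obtain \<phi>' where dom: "dominant_rational_map UNIV UNIV \<phi>"
    and dom': "dominant_rational_map UNIV UNIV \<phi>'"
    and inv: "generic_on UNIV (\<lambda>z. \<phi>' (\<phi> z) = z)" "generic_on UNIV (\<lambda>z. \<phi> (\<phi>' z) = z)"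
    using birational unfolding birational_map_def by blast
  \<comment> \<open>Substituting \<open>\<phi>' z\<close> and applying the inverse isometry shows
    that \<open>\<phi>'\<close> belongs to the inverse symmetry.\<close>
  have "generic_on UNIV (\<lambda>z. Q *v ruled_map p q (\<phi>' z) + b = ruled_map p q (\<phi> (\<phi>' z)))"
    using dominant_pullback[OF dom' commutes] by simp
  from generic_on_UNIV_conj[OF this inv(2)]
  have commutes': "generic_on UNIV (\<lambda>z. transpose Q *v ruled_map p q z + - (transpose Q *v b) =
      ruled_map p q (\<phi>' z))"
    by (rule generic_on_mono) (metis orthogonal_affine_inverse(1)[OF Q])
  obtain \<psi> a c where lim: "filterlim \<psi> cofinite cofinite"
    and \<psi>: "\<forall>\<^sub>F t in cofinite. a t \<noteq> 0 \<and> Q *v direction q t = a t *\<^sub>R direction q (\<psi> t) \<and>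
       (\<forall>\<^sub>F s in cofinite. \<phi> (t, s) = (\<psi> t, a t * s + c t))"
    by (rule symmetry_fibre_preserving[OF proper not_doubly_ruled nz symmetry dom commutes])
  obtain \<psi>' a' c' where
    \<psi>': "\<forall>\<^sub>F t in cofinite. a' t \<noteq> 0 \<and> transpose Q *v direction q t = a' t *\<^sub>R direction q (\<psi>' t) \<and>
       (\<forall>\<^sub>F s in cofinite. \<phi>' (t, s) = (\<psi>' t, a' t * s + c' t))"
    by (rule symmetry_fibre_preserving[OF proper not_doubly_ruled nz
          isometry_symmetry_inverse[OF symmetry] dom' commutes'])
  have rational: "rational_function_on UNIV (\<lambda>z. fst (h z))" "rational_function_on UNIV (\<lambda>z. snd (h z))"
    if "dominant_rational_map UNIV UNIV h" for h :: "real \<times> real \<Rightarrow> real \<times> real"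
  proof -
    have *: "rational_function_on UNIV (\<lambda>z. h z \<bullet> b)" if "b \<in> Basis" for b
      using that \<open>dominant_rational_map UNIV UNIV h\<close> unfolding dominant_rational_map_def by blast
    show "rational_function_on UNIV (\<lambda>z. fst (h z))" "rational_function_on UNIV (\<lambda>z. snd (h z))"
      using *[of "(1, 0)"] *[of "(0, 1)"] by (simp_all add: Basis_prod_def inner_prod_def)
  qed
  have fst_rational: "cofinitely_rational F"
    if "dominant_rational_map UNIV UNIV h" "\<forall>\<^sub>F t in cofinite. \<forall>\<^sub>F s in cofinite. fst (h (t, s)) = F t"
    for h :: "real \<times> real \<Rightarrow> real \<times> real" and F
    using cofinitely_rational_section[OF rational(1)[OF that(1)], of "\<lambda>_. 0" F] that(2)
    by (simp add: cofinitely_rational_const)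
  have fst_\<phi>: "\<forall>\<^sub>F t in cofinite. \<forall>\<^sub>F s in cofinite. fst (\<phi> (t, s)) = \<psi> t"
    using \<psi> by eventually_elim (auto elim: eventually_mono)
  have \<psi>_rational: "cofinitely_rational \<psi>" using dom fst_\<phi> by (rule fst_rational)
  have \<psi>'_rational: "cofinitely_rational \<psi>'"
    using \<psi>' by (intro fst_rational[OF dom']) (auto elim!: eventually_mono)
  have "\<forall>\<^sub>F t in cofinite. \<psi>' (\<psi> t) = t"
    using \<psi> eventually_compose_filterlim[OF \<psi>' lim] generic_on_UNIV_imp_cofinite[OF inv(1)]
  proof eventually_elim
    case (elim t)
    \<comment> \<open>As \<open>a t\<close> is nonzero, \<open>\<phi>\<close> carries almost all
      points over \<open>t\<close> to unexceptional points over \<open>\<psi> t\<close>, where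
      \<open>\<phi>'\<close> has its normal form.\<close>
    have "inj (\<lambda>s. a t * s + c t)" using elim(1) by (simp add: inj_def)
    then have "filterlim (\<lambda>s. a t * s + c t) cofinite cofinite" by (rule filterlim_cofinite_inj)
    moreover have "\<forall>\<^sub>F s in cofinite. fst (\<phi>' (\<psi> t, s)) = \<psi>' (\<psi> t)"
      using elim(2) by (auto elim: eventually_mono)
    ultimately have "\<forall>\<^sub>F s in cofinite. fst (\<phi>' (\<psi> t, a t * s + c t)) = \<psi>' (\<psi> t)"
      by (rule eventually_compose_filterlim[rotated])
    moreover have "\<forall>\<^sub>F s in cofinite. \<phi> (t, s) = (\<psi> t, a t * s + c t)" using elim(1) by blast
    ultimately have "\<forall>\<^sub>F s::real in cofinite. \<psi>' (\<psi> t) = t"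
      using elim(3) by eventually_elim (metis fst_conv)
    then show ?case by (rule eventually_cofinite_realE)
  qed
  from moebius_of_left_invertible[OF \<psi>_rational \<psi>'_rational lim this]
  obtain \<alpha> \<beta> \<gamma> \<delta> where det: "\<alpha> * \<delta> - \<beta> * \<gamma> \<noteq> 0"
    and moebius: "\<forall>\<^sub>F t in cofinite. \<psi> t = (\<alpha> * t + \<beta>) / (\<gamma> * t + \<delta>)" by blast
  have "\<forall>\<^sub>F t in cofinite. a t \<noteq> 0 \<and> Q *v direction q t = a t *\<^sub>R direction q (\<psi> t)"
    using \<psi> by eventually_elim blast
  moreover obtain k0 where "coeff (q $ k0) n \<noteq> 0" using Max_degree_coeff(2)[OF n \<open>q \<noteq> 0\<close>] by blast
  ultimately obtain k where k: "\<forall>\<^sub>F t in cofinite. a t = k * (\<gamma> * t + \<delta>) ^ n"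
    using scaling_factor[OF bezout Max_degree_coeff(1)[OF n \<open>q \<noteq> 0\<close>] _ Q det moebius] by blast
  have "\<forall>\<^sub>F t in cofinite. \<forall>\<^sub>F s in cofinite. snd (\<phi> (t, s)) = a t * s + c t"
    using \<psi> by eventually_elim (auto elim: eventually_mono)
  \<comment> \<open>Only the explicit form of \<open>a\<close> shows that it is rational, and
    \<open>c\<close> can be isolated only after that.\<close>
  moreover have "cofinitely_rational a"
    by (rule cofinitely_rational_cong[OF cofinitely_rational_poly[of "smult k ([:\<delta>, \<gamma>:] ^ n)"]])
      (use k in eventually_elim, simp add: algebra_simps)
  ultimately have "cofinitely_rational c" using cofinitely_rational_section[OF rational(2)[OF dom]] by blast
  then obtain u v where v: "v \<noteq> 0" and c: "\<forall>\<^sub>F t in cofinite. c t = poly u t / poly v t"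
    unfolding cofinitely_rational_def by blast
  have rat_c: "\<forall>\<^sub>F t in cofinite. rat_eval (Fract u v) t = c t"
    using c poly_eventually_nonzero[OF v] by eventually_elim (simp add: rat_eval_Fract)
  have fst_eq: "generic_on UNIV (\<lambda>z. fst (\<phi> z) = (\<alpha> * fst z + \<beta>) / (\<gamma> * fst z + \<delta>))"
  proof (rule rational_functions_generic_eqI[OF rational(1)[OF dom]])
    have "[:\<delta>, \<gamma>:] \<noteq> 0" using det by auto
    from rational_function_on_divide_poly[OF this, of "[:\<beta>, \<alpha>:]"]
    show "rational_function_on UNIV (\<lambda>z::real \<times> real. (\<alpha> * fst z + \<beta>) / (\<gamma> * fst z + \<delta>))"
      by (simp add: algebra_simps)
    show "\<forall>\<^sub>F t in cofinite. \<forall>\<^sub>F s in cofinite.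
        fst (\<phi> (t, s)) = (\<alpha> * fst (t, s) + \<beta>) / (\<gamma> * fst (t, s) + \<delta>)"
      using fst_\<phi> moebius by eventually_elim simp
  qed
  have snd_eq: "generic_on UNIV (\<lambda>z. snd (\<phi> z) =
      k * (\<gamma> * fst z + \<delta>) ^ n * snd z + rat_eval (Fract u v) (fst z))"
  proof (rule rational_functions_generic_eqI[OF rational(2)[OF dom]])
    have "rational_function_on UNIV
        (\<lambda>z::real \<times> real. poly (smult k ([:\<delta>, \<gamma>:] ^ n)) (fst z) * snd z)"
      by (intro rational_function_on_polynomial real_polynomial_function.intros(4)
          real_polynomial_function_poly real_polynomial_function_fst real_polynomial_function_snd)
    then show "rational_function_on UNIV (\<lambda>z::real \<times> real.
        k * (\<gamma> * fst z + \<delta>) ^ n * snd z + rat_eval (Fract u v) (fst z))"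
      unfolding rat_eval_def
      by (intro rational_function_on_add rational_function_on_divide_poly snd_quot_of_fract_nonzero)
        (simp add: algebra_simps)
    show "\<forall>\<^sub>F t in cofinite. \<forall>\<^sub>F s in cofinite. snd (\<phi> (t, s)) =
        k * (\<gamma> * fst (t, s) + \<delta>) ^ n * snd (t, s) + rat_eval (Fract u v) (fst (t, s))"
      using \<psi> k rat_c by eventually_elim (auto elim: eventually_mono)
  qed
  have "generic_on UNIV (\<lambda>(t, s). \<phi> (t, s) = ((\<alpha> * t + \<beta>) / (\<gamma> * t + \<delta>),
      k * (\<gamma> * t + \<delta>) ^ n * s + rat_eval (Fract u v) t))"
    using generic_on_UNIV_conj[OF fst_eq snd_eq] by (rule generic_on_mono) (auto simp: prod_eq_iff)
  with det show ?thesis by blast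
qed

end
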